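(* Let $\ell\geq 0$ be an integer and let $f\in\mathcal{H}$ be of type $x^{\ell+}$. Then there exists $\sigma=\sigma(f)>0$, depending only on $f$, such that for every $\varepsilon>0$ and all integers $N\geq1$, \[ W(E_N(f))\ll N^{1-\sigma+\varepsilon}, \] where the implied constant may depend on $f$ and $\varepsilon$.
   Context: Two real functions are equivalent if they agree on some interval $(x_0,\infty)$; the equivalence classes (germs at $+\infty$) form a ring $B$. A Hardy field is a subfield of $B$ closed under differentiation, and $\mathcal{H}$ denotes the union of all Hardy fields; each $f\in\mathcal{H}$ is taken to be defined on $[1,\infty)$. For $f,g\in\mathcal{H}$ write $f\prec g$ if $f(x)/g(x)\to0$ as $x\to\infty$. The growth exponent is $\beta(f)=\inf\{c\in[0,\infty)\colon f(x)\prec x^c\}$. For an integer $\ell\geq0$, $f\in\mathcal{H}$ is of type $x^{\ell+}$ if $x^\ell\prec f(x)\prec x^{\ell+1}$ and $\beta(f)>0$. Define $\chi(x)=+1$ if $0\le\{x\}<1/2$ and $\chi(x)=-1$ if $1/2\le\{x\}<1$, where $\{x\}$ is the fractional part. For $N\ge1$, $E_N(f)=(e_1,\dots,e_N)$ with $e_n=\chi(f(n))$. The well-distribution measure of a sequence $E_N=(e_1,\dots,e_N)\in\{-1,+1\}^N$ is \[W(E_N)=\max_{a,b,M}\Big|\sum_{n=1}^M e_{an+b}\Big|,\] the maximum over all $b\in\mathbb{Z}$, $a,M\in\mathbb{N}$ with $1\le a+b\le aM+b\le N$. *)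

theory Defs
  imports "HOL-Algebra.Subrings" "HOL-Analysis.Analysis"
begin

quotient_type germ = "real \<Rightarrow> real" / "\<lambda>f g. \<forall>\<^sub>F x in at_top. f x = g x"
  morphisms rep_germ germ_of
proof (rule equivpI)
  show "reflp (\<lambda>f g :: real \<Rightarrow> real. \<forall>\<^sub>F x in at_top. f x = g x)"
    by (rule reflpI) simp
  show "symp (\<lambda>f g :: real \<Rightarrow> real. \<forall>\<^sub>F x in at_top. f x = g x)"
    by (rule sympI) (simp add: eq_commute)
  show "transp (\<lambda>f g :: real \<Rightarrow> real. \<forall>\<^sub>F x in at_top. f x = g x)"
    by (rule transpI) (auto elim: eventually_elim2)
qed

instantiation germ :: comm_ring_1
begin

lift_definition zero_germ :: germ is "\<lambda>_. 0" .
lift_definition one_germ :: germ is "\<lambda>_. 1" .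
lift_definition plus_germ :: "germ \<Rightarrow> germ \<Rightarrow> germ" is "\<lambda>f g x. f x + g x"
  by (auto elim: eventually_elim2)
lift_definition minus_germ :: "germ \<Rightarrow> germ \<Rightarrow> germ" is "\<lambda>f g x. f x - g x"
  by (auto elim: eventually_elim2)
lift_definition uminus_germ :: "germ \<Rightarrow> germ" is "\<lambda>f x. - f x"
  by simp
lift_definition times_germ :: "germ \<Rightarrow> germ \<Rightarrow> germ" is "\<lambda>f g x. f x * g x"
  by (auto elim: eventually_elim2)

instance
  by standard (transfer; simp add: algebra_simps)+

end

definition germ_ring :: "germ ring" where
  "germ_ring = \<lparr>carrier = UNIV, monoid.mult = (*), one = 1, zero = 0, add = (+)\<rparr>"

lemma cring_germ_ring: "cring germ_ring"
proof (rule cringI)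
  have "\<exists>y. y + x = 0" for x :: germ
    by (rule exI[of _ "- x"]) simp
  then show "abelian_group germ_ring"
    by (intro abelian_groupI) (simp_all add: germ_ring_def add_ac)
  show "Group.comm_monoid germ_ring"
    by (intro comm_monoidI) (simp_all add: germ_ring_def mult_ac)
qed (simp add: germ_ring_def distrib_right)

definition hardy_field :: "germ set \<Rightarrow> bool" where
  "hardy_field K \<longleftrightarrow> subfield K germ_ring \<and>
     (\<forall>f. germ_of f \<in> K \<longrightarrow>
        (\<exists>g. germ_of g \<in> K \<and> (\<forall>\<^sub>F x in at_top. (f has_real_derivative g x) (at x))))"

text \<open>The elements are total functions whose germ lies in a Hardy field; only their values on
  \<open>[1, \<infinity>)\<close> are ever relevant.\<close>

definition hardy_functions :: "(real \<Rightarrow> real) set" where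
  "hardy_functions = {f. \<exists>K. hardy_field K \<and> germ_of f \<in> K}"

text \<open>The first conjunct is the presupposition of the quotient; without it, \<open>y / 0 = 0\<close>
  would put every function below one that vanishes eventually.\<close>

definition growth_less :: "(real \<Rightarrow> real) \<Rightarrow> (real \<Rightarrow> real) \<Rightarrow> bool" where
  "growth_less f g \<longleftrightarrow>
     (\<forall>\<^sub>F x in at_top. g x \<noteq> 0) \<and> ((\<lambda>x. f x / g x) \<longlongrightarrow> 0) at_top"

text \<open>Extended reals, so that the infimum is \<open>\<infinity>\<close> for functions of superpolynomial growth.\<close>

definition growth_exponent :: "(real \<Rightarrow> real) \<Rightarrow> ereal" where
  "growth_exponent f = (INF c \<in> {c. 0 \<le> c \<and> growth_less f (\<lambda>x. x powr c)}. ereal c)"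

definition of_type_power_plus :: "nat \<Rightarrow> (real \<Rightarrow> real) \<Rightarrow> bool" where
  "of_type_power_plus l f \<longleftrightarrow>
     growth_less (\<lambda>x. x ^ l) f \<and> growth_less f (\<lambda>x. x ^ (l + 1)) \<and> growth_exponent f > 0"

definition chi :: "real \<Rightarrow> int" where
  "chi x = (if frac x < 1 / 2 then 1 else - 1)"

definition sign_sequence :: "nat \<Rightarrow> (real \<Rightarrow> real) \<Rightarrow> int list" where
  "sign_sequence N f = map (\<lambda>n. chi (f (real n))) [1..<N + 1]"

text \<open>A sequence \<open>(e\<^sub>1, \<dots>, e\<^sub>N)\<close> is a list of length \<open>N\<close>, and \<open>e\<^sub>i\<close> is the list entry at
  position \<open>i - 1\<close>.\<close>

definition well_distribution_values :: "int list \<Rightarrow> int set" where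
  "well_distribution_values E =
     {\<bar>\<Sum>n = 1..M. E ! nat (int a * int n + b - 1)\<bar> | (a :: nat) (b :: int) (M :: nat).
        1 \<le> a \<and> 1 \<le> M \<and> 1 \<le> int a + b \<and> int a + b \<le> int a * int M + b \<and>
        int a * int M + b \<le> int (length E)}"

definition well_distribution :: "int list \<Rightarrow> int" where
  "well_distribution E = Max (well_distribution_values E)"

lemma well_distribution_values_nonempty:
  assumes "E \<noteq> []"
  shows "well_distribution_values E \<noteq> {}"
proof -
  have "1 \<le> length E"
    using assms by (cases E) auto
  then have "\<bar>\<Sum>n = 1..1. E ! nat (int 1 * int n + 0 - 1)\<bar> \<in> well_distribution_values E"
    unfolding well_distribution_values_def mem_Collect_eq
    by (intro exI[of _ "1 :: nat"] exI[of _ "0 :: int"]) simp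
  then show ?thesis by blast
qed

lemma finite_well_distribution_values: "finite (well_distribution_values E)"
proof -
  define B where "B = (\<Sum>i<length E. \<bar>E ! i\<bar>)"
  have B: "\<bar>E ! i\<bar> \<le> B" if "i < length E" for i
    unfolding B_def using that by (intro member_le_sum) auto
  have B0: "0 \<le> B"
    unfolding B_def by (intro sum_nonneg) auto
  have "\<bar>\<Sum>n = 1..M. E ! nat (int a * int n + b - 1)\<bar> \<le> int (length E) * B"
    if a: "1 \<le> a" and M: "1 \<le> M" and lo: "1 \<le> int a + b"
      and hi: "int a * int M + b \<le> int (length E)" for a M :: nat and b :: int
  proof -
    have "int M - 1 \<le> int a * (int M - 1)"
      using a M by (simp add: mult_le_cancel_right1)
    then have M_le: "int M \<le> int (length E)"
      using lo hi by (simp add: algebra_simps)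
    have "\<bar>E ! nat (int a * int n + b - 1)\<bar> \<le> B" if n: "n \<in> {1..M}" for n
    proof (rule B)
      have "int a * 1 \<le> int a * int n" "int a * int n \<le> int a * int M"
        using n by (intro mult_left_mono; simp)+
      then show "nat (int a * int n + b - 1) < length E"
        using lo hi by linarith
    qed
    then have "\<bar>\<Sum>n = 1..M. E ! nat (int a * int n + b - 1)\<bar> \<le> (\<Sum>n = 1..M. B)"
      by (intro order.trans[OF sum_abs] sum_mono)
    also have "\<dots> \<le> int (length E) * B"
      using M_le B0 by (simp add: mult_right_mono)
    finally show ?thesis .
  qed
  then have "well_distribution_values E \<subseteq> {0..int (length E) * B}"
    unfolding well_distribution_values_def by auto
  then show ?thesis
    by (rule finite_subset) simp
qed

end

theory Submission
  imports Defs "HOL-Real_Asymp.Real_Asymp"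
begin

text \<open>
  Put \<open>k = l + 2\<close>. Since every germ in a Hardy field has eventually constant sign, and comparison
  with rational powers of \<open>x\<close> is decided by the sign of \<open>q x h' - p h\<close>, the derivative \<open>f\<^sup>(\<^sup>k\<^sup>)\<close> is
  eventually squeezed between \<open>x\<^sup>c\<close> and \<open>x\<^sup>c\<^sup>+\<^sup>\<rho>\<close> for an arbitrarily small \<open>\<rho>\<close>. Integrating \<open>k\<close>
  times, the growth conditions on \<open>f\<close> force \<open>- k < c < 0\<close>, strictly bounded away from the end points.

  Hence there is a block length \<open>L\<close> for which the \<open>k\<close>-th differences of \<open>f\<close> along a progression of
  small modulus are at most \<open>L\<^sup>1\<^sup>-\<^sup>k\<close> times a negative power of \<open>N\<close>, and at least \<open>L\<^sup>-\<^sup>k\<close> times a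
  positive one. On each block, \<open>k - 1\<close> Weyl differencing steps followed by the Kusmin--Landau
  inequality save a power of \<open>N\<close> in the exponential sums with frequencies up to a small power of
  \<open>N\<close>. A trigonometric majorant of the indicator function of a half circle, applied to the
  sequence and to its translate by \<open>1/2\<close>, transfers the saving to \<open>\<chi>\<close>. Progressions of large modulus
  and the initial part of the range are estimated trivially.
\<close>

section \<open>Exponential sums\<close>

text \<open>The order \<open>k = l + 2\<close> is dictated by logarithmic borderline cases. For f(x)
  = x^(l+1) / log x the derivative of order l + 1 decays only like 1 / log x, which yields no power
  of N, while the next one has size about 1 / x. At the other end, c = - k would force blocks as
  long as the whole range. For l = 0 this is the behaviour of log x, excluded by \<beta>(f) > 0; for
  l \<ge> 1 an exponent near - k would make f = O(x^l), against x^l \<prec> f.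

  No asymptotic formula for the derivatives is available, and the Hardy field need not contain x or
  its powers. Both obstacles are met by locating the exponent only up to \<rho>. The loss is a
  factor X^\<rho>, and it is harmless because \<rho> is chosen after the exponents \<eta> and
  \<sigma> of the saving, which depend on l and on a lower bound 1 / m for c + k, but not on c
  itself.\<close>

lemma sin_pi_mult_ge:
  fixes v :: real
  assumes "0 \<le> v" "v \<le> 1 / 2"
  shows "v \<le> sin (pi * v)"
proof -
  define t where "t = pi * v"
  have t0: "0 \<le> t" using assms by (simp add: t_def)
  have "t \<le> pi * (1/2)" unfolding t_def using assms by (intro mult_left_mono) auto
  then have t2: "t \<le> 2" using pi_half_less_two by simp
  have "\<bar>sin t - (\<Sum>m<3. sin_coeff m * t ^ m)\<bar> \<le> inverse (fact 3) * \<bar>t\<bar> ^ 3"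
    by (rule Maclaurin_sin_bound)
  moreover have "(\<Sum>m<3. sin_coeff m * t ^ m) = t"
    by (simp add: numeral_3_eq_3 sin_coeff_def)
  moreover have "fact 3 = (6::real)" by (simp add: fact_numeral)
  ultimately have "t - t ^ 3 / 6 \<le> sin t" using t0 by (simp add: abs_if field_simps split: if_splits)
  \<comment> \<open>With t \<le> 2 the cubic term t^3 / 6 costs at most 2 t / 3; the remaining t / 3
    is at least v because pi > 3.\<close>
  moreover have "t ^ 3 \<le> t * 4"
  proof -
    have "t * t\<^sup>2 \<le> t * 2\<^sup>2" using t0 t2 by (intro mult_left_mono power_mono) auto
    then show ?thesis by (simp add: power3_eq_cube power2_eq_square)
  qed
  ultimately have "t / 3 \<le> sin t" by linarith
  moreover have "v \<le> t / 3"
    using mult_right_mono[of 3 pi v] pi_gt3 assms by (simp add: t_def)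
  ultimately show ?thesis by (simp add: t_def)
qed

lemma norm_cis_minus_one: "norm (cis (2 * t) - 1) = 2 * \<bar>sin t\<bar>"
proof -
  have "cis (2 * t) - 1 = 2 * \<i> * sin t * cis t"
    by (simp add: complex_eq_iff cos_double_sin sin_double power2_eq_square)
  then show ?thesis by (simp add: norm_mult)
qed

text \<open>Summation by parts. Monotonicity makes the total variation of \<open>t\<close> collapse
  to |t m - t 0|, and t m + t 0 + |t m - t 0| is twice the larger end value.\<close>

lemma abel_summation_monotone_bound:
  fixes t :: "nat \<Rightarrow> real" and z :: "nat \<Rightarrow> complex"
  assumes mono: "(\<forall>n<m. t n \<le> t (Suc n)) \<or> (\<forall>n<m. t (Suc n) \<le> t n)"
    and t: "\<And>n. n \<le> m \<Longrightarrow> 0 \<le> t n \<and> t n \<le> T"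
    and z: "\<And>n. norm (z n) \<le> 1"
  shows "norm (\<Sum>n\<le>m. t n *\<^sub>R (z (Suc n) - z n)) \<le> 2 * T"
proof -
  have eq: "(\<Sum>n\<le>m. t n *\<^sub>R (z (Suc n) - z n)) =
      t m *\<^sub>R z (Suc m) - t 0 *\<^sub>R z 0 - (\<Sum>n<m. (t (Suc n) - t n) *\<^sub>R z (Suc n))"
    by (induction m) (simp_all add: algebra_simps)
  have tel: "(\<Sum>n<m. t (Suc n) - t n) = t m - t 0"
    by (rule sum_lessThan_telescope)
  have var: "(\<Sum>n<m. \<bar>t (Suc n) - t n\<bar>) = \<bar>t m - t 0\<bar>"
    using mono
  proof
    assume *: "\<forall>n<m. t n \<le> t (Suc n)"
    then have "(\<Sum>n<m. \<bar>t (Suc n) - t n\<bar>) = (\<Sum>n<m. t (Suc n) - t n)"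
      by (intro sum.cong) auto
    moreover have "0 \<le> (\<Sum>n<m. t (Suc n) - t n)" using * by (intro sum_nonneg) auto
    ultimately show ?thesis using tel by simp
  next
    assume *: "\<forall>n<m. t (Suc n) \<le> t n"
    then have "(\<Sum>n<m. \<bar>t (Suc n) - t n\<bar>) = (\<Sum>n<m. - (t (Suc n) - t n))"
      by (intro sum.cong) auto
    then have "(\<Sum>n<m. \<bar>t (Suc n) - t n\<bar>) = - (t m - t 0)"
      using tel by (simp only: sum_negf)
    moreover have "0 \<le> (\<Sum>n<m. \<bar>t (Suc n) - t n\<bar>)" by (intro sum_nonneg) auto
    ultimately show ?thesis by linarith
  qed
  have "norm (\<Sum>n<m. (t (Suc n) - t n) *\<^sub>R z (Suc n)) \<le> (\<Sum>n<m. \<bar>t (Suc n) - t n\<bar>)"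
  proof (rule order.trans[OF norm_sum], rule sum_mono)
    fix n
    show "norm ((t (Suc n) - t n) *\<^sub>R z (Suc n)) \<le> \<bar>t (Suc n) - t n\<bar>"
      using mult_left_mono[OF z[of "Suc n"], of "\<bar>t (Suc n) - t n\<bar>"] by simp
  qed
  moreover have "norm (t m *\<^sub>R z (Suc m)) \<le> t m"
    using mult_left_mono[OF z[of "Suc m"], of "t m"] t[of m] by simp
  moreover have "norm (t 0 *\<^sub>R z 0) \<le> t 0"
    using mult_left_mono[OF z[of 0], of "t 0"] t[of 0] by simp
  ultimately have "norm (\<Sum>n\<le>m. t n *\<^sub>R (z (Suc n) - z n)) \<le> t m + t 0 + \<bar>t m - t 0\<bar>"
    unfolding eq var
    using norm_triangle_ineq4[of "t m *\<^sub>R z (Suc m) - t 0 *\<^sub>R z 0"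
        "\<Sum>n<m. (t (Suc n) - t n) *\<^sub>R z (Suc n)"]
      norm_triangle_ineq4[of "t m *\<^sub>R z (Suc m)" "t 0 *\<^sub>R z 0"] by linarith
  then show ?thesis using t[of m] t[of 0] by (auto simp: abs_if split: if_splits)
qed

lemma cot_antimono:
  fixes a b :: real
  assumes "0 < a" "a \<le> b" "b \<le> pi / 2"
  shows "cot b \<le> cot a"
proof -
  have sa: "sin a > 0" "sin b > 0" using assms pi_gt_zero by (auto intro!: sin_gt_zero)
  have "0 \<le> sin (b - a)" using assms by (intro sin_ge_zero) auto
  then have "cos b * sin a \<le> cos a * sin b" by (simp add: sin_diff mult.commute)
  then show ?thesis using sa by (simp add: cot_def field_simps)
qed

text \<open>Since \<open>1 / (cis (2 * t) - 1) = - (1 + \<i> * cot t) / 2\<close>, each term is a multiple of the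
  difference of its neighbours, with coefficients of bounded variation.\<close>

lemma kusmin_landau:
  fixes F :: "nat \<Rightarrow> real"
  assumes lam: "0 < \<mu>" "\<mu> \<le> 1 / 2"
    and d: "\<And>n. n + 1 < M \<Longrightarrow> \<mu> \<le> F (n + 1) - F n \<and> F (n + 1) - F n \<le> 1 / 2"
    and mono: "(\<forall>n. n + 2 < M \<longrightarrow> F (n + 1) - F n \<le> F (n + 2) - F (n + 1)) \<or>
               (\<forall>n. n + 2 < M \<longrightarrow> F (n + 2) - F (n + 1) \<le> F (n + 1) - F n)"
  shows "norm (\<Sum>n<M. cis (2 * pi * F n)) \<le> 2 / \<mu>"
proof (cases "M < 2")
  case True
  have "norm (\<Sum>n<M. cis (2 * pi * F n)) \<le> (\<Sum>n<M. norm (cis (2 * pi * F n)))"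
    by (rule norm_sum)
  also have "\<dots> \<le> 1" using True by simp
  also have "\<dots> \<le> 2 / \<mu>" using lam by (simp add: field_simps)
  finally show ?thesis .
next
  case False
  then obtain m where M: "M = m + 2" by (metis add.commute le_iff_add not_less)
  define z where "z n = cis (2 * pi * F n)" for n
  define \<delta> where "\<delta> n = F (n + 1) - F n" for n
  define t where "t n = cot (pi * \<delta> n)" for n
  have dl: "\<mu> \<le> \<delta> n" "\<delta> n \<le> 1 / 2" if "n \<le> m" for n
    using d[of n] that by (simp_all add: M \<delta>_def)
  have pos: "sin (pi * \<delta> n) \<ge> \<delta> n" if "n \<le> m" for n
    using dl[OF that] lam by (intro sin_pi_mult_ge) auto
  have t: "0 \<le> t n \<and> t n \<le> 1 / \<mu>" if "n \<le> m" for n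
  proof
    have s: "sin (pi * \<delta> n) \<ge> \<mu>" using pos[OF that] dl[OF that] by linarith
    have "pi * \<delta> n \<le> pi * (1/2)" using dl[OF that] by (intro mult_left_mono) auto
    then have "cos (pi * \<delta> n) \<ge> 0"
      using dl[OF that] lam by (intro cos_ge_zero order.trans[OF _ mult_nonneg_nonneg]) auto
    then show "0 \<le> t n" using s lam by (simp add: t_def cot_def)
    have "t n \<le> 1 / sin (pi * \<delta> n)"
      using s lam by (simp add: t_def cot_def divide_right_mono)
    also have "\<dots> \<le> 1 / \<mu>" using s lam by (intro divide_left_mono) auto
    finally show "t n \<le> 1 / \<mu>" .
  qed
  have cotm: "t n' \<le> t n" if "n \<le> m" "n' \<le> m" "\<delta> n \<le> \<delta> n'" for n n'
    unfolding t_def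
  proof (rule cot_antimono)
    show "0 < pi * \<delta> n" using dl[OF that(1)] lam by simp
    show "pi * \<delta> n \<le> pi * \<delta> n'" using that by (intro mult_left_mono) auto
    show "pi * \<delta> n' \<le> pi / 2" using mult_left_mono[OF dl(2)[OF that(2)], of pi] by simp
  qed
  have tm: "(\<forall>n<m. t n \<le> t (Suc n)) \<or> (\<forall>n<m. t (Suc n) \<le> t n)"
    using mono
  proof
    assume "\<forall>n. n + 2 < M \<longrightarrow> F (n + 1) - F n \<le> F (n + 2) - F (n + 1)"
    then have "\<forall>n<m. \<delta> n \<le> \<delta> (Suc n)" by (simp add: M \<delta>_def)
    then show ?thesis using cotm by auto
  next
    assume "\<forall>n. n + 2 < M \<longrightarrow> F (n + 2) - F (n + 1) \<le> F (n + 1) - F n"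
    then have "\<forall>n<m. \<delta> (Suc n) \<le> \<delta> n" by (simp add: M \<delta>_def)
    then show ?thesis using cotm by auto
  qed
  have zn: "z n = - (1 / 2) *\<^sub>R (z (Suc n) - z n) - (\<i> / 2) * (t n *\<^sub>R (z (Suc n) - z n))"
    if "n \<le> m" for n
  proof -
    define u where "u = pi * \<delta> n"
    have s: "sin u \<noteq> 0" using pos[OF that] dl[OF that] lam by (simp add: u_def)
    have zs: "z (Suc n) = z n * cis (2 * u)"
      by (simp add: z_def cis_mult u_def \<delta>_def algebra_simps)
    have "cis (2 * u) - 1 = 2 * \<i> * sin u * cis u"
      by (simp add: complex_eq_iff cos_double_sin sin_double power2_eq_square)
    moreover have "- (1/2) - (\<i> / 2) * complex_of_real (cot u) = - (\<i> / 2) * cis (- u) / sin u"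
      using s by (simp add: complex_eq_iff cot_def)
    moreover have "- (\<i> / 2) * cis (- u) / sin u * (2 * \<i> * sin u * cis u) = cis (- u) * cis u"
      using s by (simp add: field_simps)
    ultimately have "1 = (- (1/2) - (\<i> / 2) * complex_of_real (cot u)) * (cis (2 * u) - 1)"
      by (simp add: cis_mult)
    then have "z n = z n * ((- (1/2) - (\<i> / 2) * complex_of_real (cot u)) * (cis (2 * u) - 1))"
      by simp
    also have "\<dots> = - (1 / 2) *\<^sub>R (z (Suc n) - z n) - (\<i> / 2) * (t n *\<^sub>R (z (Suc n) - z n))"
      unfolding zs t_def u_def[symmetric] by (simp add: scaleR_conv_of_real field_simps)
    finally show ?thesis .
  qed
  have "(\<Sum>n\<le>m. z n) = - (1 / 2) *\<^sub>R (\<Sum>n\<le>m. z (Suc n) - z n)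
      - (\<i> / 2) * (\<Sum>n\<le>m. t n *\<^sub>R (z (Suc n) - z n))"
    unfolding scaleR_sum_right sum_distrib_left sum_subtractf[symmetric]
    by (rule sum.cong[OF refl], rule zn, simp)
  also have "(\<Sum>n\<le>m. z (Suc n) - z n) = z (Suc m) - z 0"
    by (induction m) auto
  \<comment> \<open>The last term \<open>z (Suc m)\<close> has no successor in the range and is kept
    apart. It and the telescoped half difference cost at most 1 each; since \<mu> \<le> 1 / 2, these
    2 are at most 1 / \<mu>.\<close>
  finally have S: "(\<Sum>n<M. z n) = z (Suc m) - (1 / 2) *\<^sub>R (z (Suc m) - z 0)
      - (\<i> / 2) * (\<Sum>n\<le>m. t n *\<^sub>R (z (Suc n) - z n))"
    by (simp add: M lessThan_Suc_atMost)
  have z1: "norm (z n) = 1" for n by (simp add: z_def)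
  have "norm (\<Sum>n\<le>m. t n *\<^sub>R (z (Suc n) - z n)) \<le> 2 * (1 / \<mu>)"
    by (rule abel_summation_monotone_bound[OF tm t]) (simp_all add: z1)
  then have A: "norm ((\<i> / 2) * (\<Sum>n\<le>m. t n *\<^sub>R (z (Suc n) - z n))) \<le> 1 / \<mu>"
    by (simp add: norm_mult)
  have B: "norm ((1 / 2) *\<^sub>R (z (Suc m) - z 0)) \<le> 1"
    using norm_triangle_ineq4[of "z (Suc m)" "z 0"] z1 by simp
  have "norm (\<Sum>n<M. z n) \<le> 1 + 1 + 1 / \<mu>"
    unfolding S using A B z1[of "Suc m"]
    norm_triangle_ineq4[of "z (Suc m) - (1 / 2) *\<^sub>R (z (Suc m) - z 0)" "(\<i> / 2) * (\<Sum>n\<le>m. t n *\<^sub>R (z (Suc n) - z n))"]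
    norm_triangle_ineq4[of "z (Suc m)" "(1 / 2) *\<^sub>R (z (Suc m) - z 0)"] by linarith
  also have "\<dots> \<le> 2 / \<mu>" using lam by (simp add: field_simps)
  finally show ?thesis by (simp add: z_def)
qed

section \<open>Weyl differencing and iterated forward differences\<close>

text \<open>Squaring out gives M diagonal terms of modulus 1 and, for every shift h, the products of
  terms at distance h together with their conjugates. The identity is exact and uses all shifts; it
  also yields the Fourier expansion of \<open>dirichlet_weight\<close>.\<close>

lemma weyl_differencing:
  fixes z :: "nat \<Rightarrow> complex"
  assumes "\<And>n. norm (z n) = 1"
  shows "(norm (\<Sum>n<M. z n))\<^sup>2 =
    real M + 2 * Re (\<Sum>h=1..<M. \<Sum>n<M - h. z (n + h) * cnj (z n))"
proof (induction M)
  case 0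
  show ?case by simp
next
  case (Suc M)
  define T where "T = (\<Sum>n<M. z n)"
  have "(\<Sum>h=1..<Suc M. \<Sum>n<Suc M - h. z (n + h) * cnj (z n)) =
     (\<Sum>h=1..<Suc M. (\<Sum>n<M - h. z (n + h) * cnj (z n)) + z M * cnj (z (M - h)))"
  proof (rule sum.cong)
    fix h assume "h \<in> {1..<Suc M}"
    then have "Suc M - h = Suc (M - h)" "M - h + h = M" by auto
    then show "(\<Sum>n<Suc M - h. z (n + h) * cnj (z n)) =
      (\<Sum>n<M - h. z (n + h) * cnj (z n)) + z M * cnj (z (M - h))" by simp
  qed simp
  also have "\<dots> = (\<Sum>h=1..<Suc M. \<Sum>n<M - h. z (n + h) * cnj (z n))
      + z M * cnj (\<Sum>h=1..<Suc M. z (M - h))"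
    by (simp only: sum.distrib sum_distrib_left cnj_sum)
  also have "(\<Sum>h=1..<Suc M. z (M - h)) = T"
    unfolding T_def
    by (rule sum.reindex_bij_witness[of _ "\<lambda>i. M - i" "\<lambda>i. M - i"]) auto
  also have "(\<Sum>h=1..<Suc M. \<Sum>n<M - h. z (n + h) * cnj (z n)) =
     (\<Sum>h=1..<M. \<Sum>n<M - h. z (n + h) * cnj (z n))"
    by (cases "M = 0") auto
  finally have eq: "(\<Sum>h=1..<Suc M. \<Sum>n<Suc M - h. z (n + h) * cnj (z n)) =
     (\<Sum>h=1..<M. \<Sum>n<M - h. z (n + h) * cnj (z n)) + z M * cnj T" .
  have "(norm (\<Sum>n<Suc M. z n))\<^sup>2 = (norm T)\<^sup>2 + (norm (z M))\<^sup>2 + 2 * Re (z M * cnj T)"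
    by (simp only: sum.lessThan_Suc T_def[symmetric] cmod_power2)
      (simp add: power2_eq_square algebra_simps)
  then show ?case
    unfolding eq using Suc.IH by (simp add: T_def[symmetric] assms)
qed

text \<open>Forward differences with step 1. Differencing the argument first suits inductions in
  which \<open>F\<close> varies; \<open>fdiff_Suc_diff\<close> recovers the form in which the last
  difference is outermost.\<close>

fun fdiff :: "nat \<Rightarrow> (nat \<Rightarrow> real) \<Rightarrow> nat \<Rightarrow> real" where
  "fdiff 0 F = F"
| "fdiff (Suc k) F = fdiff k (\<lambda>n. F (n + 1) - F n)"

lemma fdiff_add: "fdiff k (\<lambda>n. F n + G n) n = fdiff k F n + fdiff k G n"
proof (induction k arbitrary: F G)
  case (Suc k)
  have "fdiff k (\<lambda>n. F (n + 1) + G (n + 1) - (F n + G n)) n =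
        fdiff k (\<lambda>n. (F (n + 1) - F n) + (G (n + 1) - G n)) n"
    by (simp add: algebra_simps)
  then show ?case by (simp only: Suc.IH fdiff.simps)
qed simp

lemma fdiff_mult: "fdiff k (\<lambda>n. c * F n) n = c * fdiff k F n"
proof (induction k arbitrary: F)
  case (Suc k)
  have "fdiff k (\<lambda>n. c * F (n + 1) - c * F n) n = fdiff k (\<lambda>n. c * (F (n + 1) - F n)) n"
    by (simp add: algebra_simps)
  then show ?case by (simp only: Suc.IH fdiff.simps)
qed simp

lemma fdiff_shift: "fdiff k (\<lambda>n. F (n + h)) n = fdiff k F (n + h)"
  by (induction k arbitrary: F) (simp_all add: algebra_simps)

lemma fdiff_Suc_diff: "fdiff (Suc k) F n = fdiff k F (n + 1) - fdiff k F n"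
proof -
  have "fdiff k (\<lambda>n. F (n + 1) + (- 1) * F n) n = fdiff k F (n + 1) + (- 1) * fdiff k F n"
    by (simp only: fdiff_add fdiff_mult fdiff_shift)
  then show ?thesis by simp
qed

text \<open>A step of length h telescopes into h unit steps. Hence bounds \<mu> and \<nu> for the
  differences of order k + 1 of a phase become h \<mu> and h \<nu> for the differences of order k of
  the phase that arises from Weyl differencing with shift h.\<close>

lemma fdiff_step:
  "fdiff k (\<lambda>n. F (n + h) - F n) n = (\<Sum>j<h. fdiff (Suc k) F (n + j))"
proof (induction h)
  case 0
  have "fdiff k (\<lambda>n. 0 * F n) n = 0 * fdiff k F n" by (rule fdiff_mult)
  then show ?case by simp
next
  case (Suc h)
  have "(\<lambda>n. F (n + Suc h) - F n) = (\<lambda>n. (F (n + h) - F n) + (F (n + h + 1) - F (n + h)))"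
    by (simp add: algebra_simps)
  then have "fdiff k (\<lambda>n. F (n + Suc h) - F n) n =
     fdiff k (\<lambda>n. F (n + h) - F n) n + fdiff k (\<lambda>n. F (n + h + 1) - F (n + h)) n"
    by (simp only: fdiff_add)
  also have "fdiff k (\<lambda>n. F (n + h + 1) - F (n + h)) n = fdiff (Suc k) F (n + h)"
    using fdiff_shift[of k "\<lambda>n. F (n + 1) - F n" h n] by simp
  finally show ?case by (simp only: Suc.IH sum.lessThan_Suc)
qed

lemma sum_inverse_sqrt_le: "(\<Sum>h=1..M. 1 / sqrt (real h)) \<le> 2 * sqrt (real M)"
proof (induction M)
  case (Suc M)
  define a b where "a = sqrt (real M)" and "b = sqrt (real (Suc M))"
  have ab: "b\<^sup>2 = a\<^sup>2 + 1" "0 < b"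
    by (simp_all add: a_def b_def)
  have "0 \<le> (b - a)\<^sup>2" by simp
  then have "2 * a * b \<le> 2 * b * b - 1" using ab(1) by (simp add: power2_eq_square algebra_simps)
  then have "2 * a + 1 / b \<le> 2 * b" using ab(2) by (simp add: field_simps)
  then show ?case using Suc.IH by (simp add: a_def b_def)
qed simp


text \<open>Induction on k: differencing with shift h lowers the order by one and multiplies \<mu>
  and \<nu> by h \<le> L, so the condition on \<nu> L^k is inherited by h \<nu> L^(k-1). At k = 0 it
  says that first differences stay below 1 / 2, as the Kusmin--Landau inequality demands. Every
  squaring halves the exponent of the saving, which explains the power of 2.\<close>

lemma exponential_sum_bound:
  fixes F :: "nat \<Rightarrow> real"
  assumes "M \<le> L" "1 \<le> L" "0 < \<mu>" "\<nu> * real L ^ k \<le> 1 / 2" "\<mu> \<le> \<nu>"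
    and "\<And>n. n + Suc k < M \<Longrightarrow> \<mu> \<le> fdiff (Suc k) F n \<and> fdiff (Suc k) F n \<le> \<nu>"
    and "(\<forall>n. n + Suc (Suc k) < M \<longrightarrow> fdiff (Suc k) F n \<le> fdiff (Suc k) F (n + 1)) \<or>
         (\<forall>n. n + Suc (Suc k) < M \<longrightarrow> fdiff (Suc k) F (n + 1) \<le> fdiff (Suc k) F n)"
  shows "norm (\<Sum>n<M. cis (2 * pi * F n)) \<le>
    5 * real L * (\<mu> * real L ^ Suc k) powr (- 1 / 2 ^ Suc k)"
  using assms
proof (induction k arbitrary: F M \<mu> \<nu>)
  case 0
  have trivial: "norm (\<Sum>n<M. cis (2 * pi * F n)) \<le> real L"
    using norm_sum[of "\<lambda>n. cis (2 * pi * F n)" "{..<M}"] \<open>M \<le> L\<close> by simp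
  have mu2: "\<mu> \<le> 1 / 2" "\<nu> \<le> 1 / 2" using 0 by simp_all
  have kl: "norm (\<Sum>n<M. cis (2 * pi * F n)) \<le> 2 / \<mu>"
  proof (rule kusmin_landau)
    show "0 < \<mu>" "\<mu> \<le> 1 / 2" using 0 mu2 by auto
    show "\<mu> \<le> F (n + 1) - F n \<and> F (n + 1) - F n \<le> 1 / 2" if "n + 1 < M" for n
      using "0.prems"(6)[of n] that mu2 by simp
    show "(\<forall>n. n + 2 < M \<longrightarrow> F (n + 1) - F n \<le> F (n + 2) - F (n + 1)) \<or>
               (\<forall>n. n + 2 < M \<longrightarrow> F (n + 2) - F (n + 1) \<le> F (n + 1) - F n)"
      using "0.prems"(7) by simp
  qed
  \<comment> \<open>The minimum of the trivial bound L and of 2 / \<mu> = 2 L / A is weakened to a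
    multiple of L / sqrt A, which covers both small and large A by one power.\<close>
  define A where "A = \<mu> * real L"
  have A: "0 < A" using 0 by (simp add: A_def)
  have Ap: "(\<mu> * real L ^ Suc 0) powr (- 1 / 2 ^ Suc 0) = 1 / sqrt A"
    using A by (simp add: A_def[symmetric] powr_minus powr_half_sqrt inverse_eq_divide)
  show ?case
    unfolding Ap
  proof (cases "A \<le> 1")
    case True
    then have "1 \<le> 1 / sqrt A" using A by simp
    then have "real L * 1 \<le> real L * (1 / sqrt A)" by (intro mult_left_mono) auto
    then show "norm (\<Sum>n<M. cis (2 * pi * F n)) \<le> 5 * real L * (1 / sqrt A)"
      using trivial by linarith
  next
    case False
    have "2 / \<mu> = 2 * real L / A" using 0 by (simp add: A_def field_simps)
    also have "\<dots> \<le> 2 * real L / sqrt A"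
      using False by (intro divide_left_mono) (auto intro: real_le_lsqrt simp: power2_eq_square)
    also have "\<dots> \<le> 5 * real L * (1 / sqrt A)" using A by (simp add: field_simps)
    finally show "norm (\<Sum>n<M. cis (2 * pi * F n)) \<le> 5 * real L * (1 / sqrt A)"
      using kl by linarith
  qed
next
  case (Suc k)
  define s :: real where "s = 1 / 2 ^ Suc k"
  have s: "0 < s" "s \<le> 1 / 2" by (simp_all add: s_def field_simps)
  define A where "A = \<mu> * real L ^ Suc (Suc k)"
  have L: "real L \<ge> 1" using Suc.prems by simp
  have A: "0 < A" using Suc.prems L by (simp add: A_def)
  have nu: "0 < \<nu>" using Suc.prems by linarith
  define z where "z n = cis (2 * pi * F n)" for n
  have Sh: "norm (\<Sum>n<M - h. z (n + h) * cnj (z n)) \<le> 5 * real L * A powr (- s) * (sqrt (real L) * (1 / sqrt (real h)))"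
    if h: "h \<in> {1..<M}" for h
  proof -
    define G where "G n = F (n + h) - F n" for n
    have hL: "real h \<le> real L" "1 \<le> real h" using h Suc.prems by auto
    have fd: "fdiff (Suc k) G n = (\<Sum>j<h. fdiff (Suc (Suc k)) F (n + j))" for n
      unfolding G_def by (rule fdiff_step)
    have "norm (\<Sum>n<M - h. cis (2 * pi * G n)) \<le>
       5 * real L * ((real h * \<mu>) * real L ^ Suc k) powr (- 1 / 2 ^ Suc k)"
    proof (rule Suc.IH[of _ _ "real h * \<nu>"])
      show "M - h \<le> L" "1 \<le> L" "0 < real h * \<mu>" "real h * \<mu> \<le> real h * \<nu>"
        using Suc.prems hL by auto
      have "real h * \<nu> * real L ^ k \<le> real L * \<nu> * real L ^ k"
        using hL nu by (intro mult_right_mono) auto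
      also have "\<dots> \<le> 1 / 2" using Suc.prems by (simp add: mult_ac)
      finally show "real h * \<nu> * real L ^ k \<le> 1 / 2" .
      show "real h * \<mu> \<le> fdiff (Suc k) G n \<and> fdiff (Suc k) G n \<le> real h * \<nu>"
        if "n + Suc k < M - h" for n
      proof -
        have *: "\<mu> \<le> fdiff (Suc (Suc k)) F (n + j)" "fdiff (Suc (Suc k)) F (n + j) \<le> \<nu>" if "j < h" for j
          using Suc.prems(6)[of "n + j"] that \<open>n + Suc k < M - h\<close> by auto
        have "(\<Sum>j<h. \<mu>) \<le> fdiff (Suc k) G n" unfolding fd using * by (intro sum_mono) auto
        moreover have "fdiff (Suc k) G n \<le> (\<Sum>j<h. \<nu>)" unfolding fd using * by (intro sum_mono) auto
        ultimately show ?thesis by simp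
      qed
      show "(\<forall>n. n + Suc (Suc k) < M - h \<longrightarrow> fdiff (Suc k) G n \<le> fdiff (Suc k) G (n + 1)) \<or>
         (\<forall>n. n + Suc (Suc k) < M - h \<longrightarrow> fdiff (Suc k) G (n + 1) \<le> fdiff (Suc k) G n)"
        using Suc.prems(7)
      proof
        assume *: "\<forall>n. n + Suc (Suc (Suc k)) < M \<longrightarrow> fdiff (Suc (Suc k)) F n \<le> fdiff (Suc (Suc k)) F (n + 1)"
        have "fdiff (Suc k) G n \<le> fdiff (Suc k) G (n + 1)" if "n + Suc (Suc k) < M - h" for n
          unfolding fd
        proof (rule sum_mono)
          fix j assume "j \<in> {..<h}"
          then show "fdiff (Suc (Suc k)) F (n + j) \<le> fdiff (Suc (Suc k)) F (n + 1 + j)"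
            using *[rule_format, of "n + j"] that by (simp add: add_ac)
        qed
        then show ?thesis by blast
      next
        assume *: "\<forall>n. n + Suc (Suc (Suc k)) < M \<longrightarrow> fdiff (Suc (Suc k)) F (n + 1) \<le> fdiff (Suc (Suc k)) F n"
        have "fdiff (Suc k) G (n + 1) \<le> fdiff (Suc k) G n" if "n + Suc (Suc k) < M - h" for n
          unfolding fd
        proof (rule sum_mono)
          fix j assume "j \<in> {..<h}"
          then show "fdiff (Suc (Suc k)) F (n + 1 + j) \<le> fdiff (Suc (Suc k)) F (n + j)"
            using *[rule_format, of "n + j"] that by (simp add: add_ac)
        qed
        then show ?thesis by blast
      qed
    qed
    also have "(real h * \<mu>) * real L ^ Suc k = A * (real h / real L)"
      using L by (simp add: A_def field_simps)
    also have "(A * (real h / real L)) powr (- 1 / 2 ^ Suc k) = A powr (- s) * (real h / real L) powr (- s)"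
      unfolding s_def using A hL by (subst powr_mult) auto
    \<comment> \<open>As h \<le> L and s \<le> 1 / 2, the exponent 1 / 2 only enlarges the bound,
      and one estimate for the sum of 1 / sqrt h then serves every order.\<close>
    also have "(real h / real L) powr (- s) \<le> (real h / real L) powr (- (1 / 2))"
      using hL s by (intro powr_mono') auto
    also have "(real h / real L) powr (- (1 / 2)) = sqrt (real L) * (1 / sqrt (real h))"
      using hL by (simp add: powr_minus powr_half_sqrt real_sqrt_divide field_simps)
    also have "(\<Sum>n<M - h. cis (2 * pi * G n)) = (\<Sum>n<M - h. z (n + h) * cnj (z n))"
      by (simp add: z_def G_def cis_cnj cis_mult algebra_simps)
    finally show ?thesis using L A by (simp add: mult_left_mono mult.assoc)
  qed
  \<comment> \<open>The condition on \<nu> forces A \<le> L, hence the diagonal term L of the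
    squared sum is also at most L^2 A^(-s).\<close>
  have "A powr s \<le> real L"
  proof -
    have "A = (\<mu> * real L ^ Suc k) * real L" by (simp add: A_def)
    also have "\<dots> \<le> (1 / 2) * real L"
      using Suc.prems L by (intro mult_right_mono order.trans[OF mult_right_mono[of \<mu> \<nu>]]) auto
    finally have AL: "A \<le> real L" using L by simp
    have "A powr s \<le> real L powr s" using AL A s by (intro powr_mono2) auto
    also have "\<dots> \<le> real L powr 1" using L s by (intro powr_mono) auto
    finally show ?thesis using L by simp
  qed
  then have diag: "real L \<le> (real L)\<^sup>2 * A powr (- s)"
    using A L by (simp add: powr_minus power2_eq_square field_simps)
  have "norm (\<Sum>h=1..<M. \<Sum>n<M - h. z (n + h) * cnj (z n)) \<le>
     (\<Sum>h=1..<M. 5 * real L * A powr (- s) * (sqrt (real L) * (1 / sqrt (real h))))"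
    by (rule order.trans[OF norm_sum sum_mono[OF Sh]])
  also have "\<dots> = 5 * real L * A powr (- s) * sqrt (real L) * (\<Sum>h=1..<M. 1 / sqrt (real h))"
    by (simp add: sum_distrib_left mult.assoc)
  also have "(\<Sum>h=1..<M. 1 / sqrt (real h)) \<le> (\<Sum>h=1..L. 1 / sqrt (real h))"
    using Suc.prems by (intro sum_mono2) auto
  also have "\<dots> \<le> 2 * sqrt (real L)" by (rule sum_inverse_sqrt_le)
  finally have "norm (\<Sum>h=1..<M. \<Sum>n<M - h. z (n + h) * cnj (z n)) \<le>
      5 * real L * A powr (- s) * sqrt (real L) * (2 * sqrt (real L))"
    by (simp add: mult_left_mono)
  also have "\<dots> = 10 * (real L)\<^sup>2 * A powr (- s)"
    by (simp add: power2_eq_square mult_ac flip: real_sqrt_mult)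
  finally have off: "norm (\<Sum>h=1..<M. \<Sum>n<M - h. z (n + h) * cnj (z n)) \<le>
      10 * (real L)\<^sup>2 * A powr (- s)" .
  have "(norm (\<Sum>n<M. z n))\<^sup>2 = real M + 2 * Re (\<Sum>h=1..<M. \<Sum>n<M - h. z (n + h) * cnj (z n))"
    by (rule weyl_differencing) (simp add: z_def)
  also have "\<dots> \<le> real L + 2 * norm (\<Sum>h=1..<M. \<Sum>n<M - h. z (n + h) * cnj (z n))"
    using Suc.prems(1) by (intro add_mono mult_left_mono complex_Re_le_cmod) simp_all
  \<comment> \<open>Origin of the constant 5: a constant C in the induction hypothesis makes the
    off-diagonal part 4 C after doubling, and the diagonal adds 1, so C^2 \<ge> 4 C + 1 is
    needed.\<close>
  also have "\<dots> \<le> 25 * (real L)\<^sup>2 * A powr (- s)"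
  proof -
    have "0 \<le> (real L)\<^sup>2 * A powr (- s)" by simp
    then show ?thesis using off diag by linarith
  qed
  also have "\<dots> = (5 * real L * A powr (- s / 2))\<^sup>2"
    using A by (simp add: power_mult_distrib power2_eq_square[of "A powr _"] flip: powr_add)
  finally have "norm (\<Sum>n<M. z n) \<le> 5 * real L * A powr (- s / 2)"
    by (rule power2_le_imp_le) simp
  moreover have "- s / 2 = - 1 / 2 ^ Suc (Suc k)" by (simp add: s_def)
  ultimately show ?case unfolding z_def A_def by (simp only:)
qed

section \<open>Equidistribution on half circles\<close>

lemma norm_geometric_sum_cis_le:
  assumes "0 < d" "d \<le> \<bar>sin (pi * u)\<bar>"
  shows "norm (\<Sum>m<H. cis (2 * pi * (real m * u))) \<le> 1 / d"
proof -
  define w where "w = cis (2 * (pi * u))"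
  have nw: "norm (w - 1) = 2 * \<bar>sin (pi * u)\<bar>" unfolding w_def by (rule norm_cis_minus_one)
  then have w: "w \<noteq> 1" using assms by auto
  have "(\<Sum>m<H. cis (2 * pi * (real m * u))) = (\<Sum>m<H. w ^ m)"
    by (intro sum.cong) (simp_all add: w_def Complex.DeMoivre mult_ac)
  also have "\<dots> = (w ^ H - 1) / (w - 1)" using w by (rule geometric_sum)
  finally have "norm (\<Sum>m<H. cis (2 * pi * (real m * u))) = norm (w ^ H - 1) / (2 * \<bar>sin (pi * u)\<bar>)"
    by (simp add: norm_divide nw)
  also have "\<dots> \<le> 2 / (2 * d)"
  proof (rule frac_le)
    show "norm (w ^ H - 1) \<le> 2"
      using norm_triangle_ineq4[of "w ^ H" 1] by (simp add: norm_power w_def)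
  qed (use assms in auto)
  finally show ?thesis by simp
qed

lemma sum_roots_of_unity_eq_0:
  assumes "0 < h" "h < H"
  shows "(\<Sum>j<H. cis (- (2 * pi * (real h * (real j / real H))))) = 0"
proof -
  define w where "w = cis (- (2 * pi * (real h / real H)))"
  have wH: "w ^ H = 1"
  proof -
    have "w ^ H = cis (2 * pi * (- real h))"
      unfolding w_def Complex.DeMoivre using assms by (intro arg_cong[of _ _ cis]) (simp add: field_simps)
    then show ?thesis using cis_multiple_2pi[of "- real h"] by simp
  qed
  have "w \<noteq> 1"
  proof
    assume "w = 1"
    then have "norm (cis (2 * (- (pi * (real h / real H)))) - 1) = 0"
      by (simp add: w_def mult.assoc)
    then have "sin (pi * (real h / real H)) = 0"
      unfolding norm_cis_minus_one by simp
    moreover have "sin (pi * (real h / real H)) > 0"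
      using assms by (intro sin_gt_zero) (auto simp: field_simps)
    ultimately show False by simp
  qed
  then have "(\<Sum>j<H. w ^ j) = 0" by (simp add: geometric_sum wH)
  moreover have "w ^ j = cis (- (2 * pi * (real h * (real j / real H))))" for j
    unfolding w_def Complex.DeMoivre by (intro arg_cong[of _ _ cis]) simp
  ultimately show ?thesis by simp
qed

text \<open>This is H times the Fejer kernel of order H, translated by j / H.\<close>

definition dirichlet_weight :: "nat \<Rightarrow> nat \<Rightarrow> real \<Rightarrow> real" where
  "dirichlet_weight H j x = (norm (\<Sum>m<H. cis (2 * pi * (real m * (x - real j / real H)))))\<^sup>2"

lemma dirichlet_weight_expand:
  "dirichlet_weight H j x = real H + 2 * Re (\<Sum>h=1..<H. complex_of_real (real (H - h)) *
     cis (- (2 * pi * (real h * (real j / real H)))) * cis (2 * pi * (real h * x)))"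
proof -
  define z where "z m = cis (2 * pi * (real m * (x - real j / real H)))" for m
  have "z (n + h) * cnj (z n) =
     cis (- (2 * pi * (real h * (real j / real H)))) * cis (2 * pi * (real h * x))" for n h
    unfolding z_def cis_cnj cis_mult by (rule arg_cong[of _ _ cis]) (simp add: algebra_simps add_divide_distrib)
  then have "(\<Sum>h=1..<H. \<Sum>n<H - h. z (n + h) * cnj (z n)) = (\<Sum>h=1..<H. complex_of_real (real (H - h)) *
     cis (- (2 * pi * (real h * (real j / real H)))) * cis (2 * pi * (real h * x)))"
    by (simp add: mult.assoc)
  moreover have "(norm (\<Sum>m<H. z m))\<^sup>2 = real H + 2 * Re (\<Sum>h=1..<H. \<Sum>n<H - h. z (n + h) * cnj (z n))"
    by (rule weyl_differencing) (simp add: z_def)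
  ultimately show ?thesis unfolding dirichlet_weight_def z_def by (simp only:)
qed

text \<open>Summation over the translates j / H kills every frequency from 1 to H - 1, since these
  give nontrivial roots of unity, and leaves H copies of the constant term H.\<close>

lemma sum_dirichlet_weight: "(\<Sum>j<H. dirichlet_weight H j x) = (real H)\<^sup>2"
proof -
  have "(\<Sum>j<H. \<Sum>h=1..<H. complex_of_real (real (H - h)) *
      cis (- (2 * pi * (real h * (real j / real H)))) * cis (2 * pi * (real h * x))) =
      (\<Sum>h=1..<H. complex_of_real (real (H - h)) * cis (2 * pi * (real h * x)) *
        (\<Sum>j<H. cis (- (2 * pi * (real h * (real j / real H))))))"
    by (subst sum.swap) (simp add: sum_distrib_left mult_ac)
  also have "\<dots> = 0"
    by (intro sum.neutral ballI) (simp add: sum_roots_of_unity_eq_0 del: times_divide_eq_right)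
  finally have "(\<Sum>j<H. Re (\<Sum>h=1..<H. complex_of_real (real (H - h)) *
      cis (- (2 * pi * (real h * (real j / real H)))) * cis (2 * pi * (real h * x)))) = 0"
    by (simp only: Re_sum[symmetric] zero_complex.sel)
  then show ?thesis
    unfolding dirichlet_weight_expand
    by (simp add: sum.distrib sum_distrib_left[symmetric] power2_eq_square del: Re_sum)
qed

text \<open>The constant term of the kernel produces the expected share H M; each of the fewer than
  H frequencies has a coefficient of modulus at most H and enters with its conjugate, hence the
  factor 2.\<close>

lemma sum_dirichlet_weight_sequence_le:
  assumes "\<And>h. 1 \<le> h \<Longrightarrow> h < H \<Longrightarrow> norm (\<Sum>n<M. cis (2 * pi * (real h * X n))) \<le> B" and "0 \<le> B"
  shows "(\<Sum>n<M. dirichlet_weight H j (X n)) \<le> real H * real M + 2 * (real H)\<^sup>2 * B"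
proof -
  let ?c = "\<lambda>h. complex_of_real (real (H - h)) * cis (- (2 * pi * (real h * (real j / real H))))"
  have "(\<Sum>n<M. Re (\<Sum>h=1..<H. ?c h * cis (2 * pi * (real h * X n)))) =
      Re (\<Sum>h=1..<H. ?c h * (\<Sum>n<M. cis (2 * pi * (real h * X n))))"
    unfolding Re_sum[symmetric] by (subst sum.swap) (simp only: sum_distrib_left)
  also have "\<dots> \<le> norm (\<Sum>h=1..<H. ?c h * (\<Sum>n<M. cis (2 * pi * (real h * X n))))"
    by (rule complex_Re_le_cmod)
  also have "\<dots> \<le> (\<Sum>h=1..<H. real H * B)"
  proof (rule order.trans[OF norm_sum sum_mono])
    fix h assume h: "h \<in> {1..<H}"
    have "norm (?c h * (\<Sum>n<M. cis (2 * pi * (real h * X n)))) =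
        real (H - h) * norm (\<Sum>n<M. cis (2 * pi * (real h * X n)))"
      by (simp add: norm_mult)
    also have "\<dots> \<le> real H * B" using h assms by (intro mult_mono) auto
    finally show "norm (?c h * (\<Sum>n<M. cis (2 * pi * (real h * X n)))) \<le> real H * B" .
  qed
  also have "\<dots> \<le> real H * (real H * B)" using assms(2) by (simp add: mult_right_mono)
  finally have "(\<Sum>n<M. Re (\<Sum>h=1..<H. ?c h * cis (2 * pi * (real h * X n)))) \<le> (real H)\<^sup>2 * B"
    by (simp only: power2_eq_square mult.assoc)
  then show ?thesis
    unfolding dirichlet_weight_expand sum.distrib sum_distrib_left[symmetric] by (simp add: mult_ac)
qed

text \<open>For fixed \<open>x\<close> the weights \<open>dirichlet_weight H j x / H\<^sup>2\<close> form a probability distribution on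
  \<open>j < H\<close> concentrated near the \<open>j\<close> with \<open>j / H\<close> close to \<open>x\<close> modulo 1. The indices far from the
  arc \<open>[0, 1/2]\<close> therefore carry little mass when \<open>frac x < 1 / 2\<close>, and the remaining weights form a
  trigonometric majorant of the indicator function of the arc.\<close>

lemma card_frac_less_half_le:
  fixes X :: "nat \<Rightarrow> real" and q :: nat
  assumes q: "4 \<le> q"
    and B: "\<And>h. 1 \<le> h \<Longrightarrow> h < 2 * q ^ 3 \<Longrightarrow> norm (\<Sum>n<M. cis (2 * pi * (real h * X n))) \<le> B"
    and B0: "0 \<le> B"
  shows "real (card {n. n < M \<and> frac (X n) < 1 / 2}) \<le> real M / 2 + 3 * real M / real q + 4 * real q ^ 3 * B"
proof -
  define H where "H = 2 * q ^ 3"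
  have H: "real H = 2 * real q ^ 3" "real H > 0" using q by (simp_all add: H_def)
  \<comment> \<open>As H = 2 q^3, the arc [0, 1/2] corresponds to indices up to q^3. It is widened
    by 2 q^2 indices, that is by 1 / q, at both ends; the second interval is the margin to the left
    of 0, wrapped around modulo 1.\<close>
  define J where "J = {..<q ^ 3 + 2 * q ^ 2} \<union> {2 * q ^ 3 - 2 * q ^ 2..<2 * q ^ 3}"
  define S where "S = {n. n < M \<and> frac (X n) < 1 / 2}"
  have fS: "finite S" "S \<subseteq> {..<M}" by (auto simp: S_def intro: finite_subset[of _ "{..<M}"])
  have q2: "4 * q ^ 2 \<le> q ^ 3" using q by (simp add: power3_eq_cube power2_eq_square)
  have JH: "J \<subseteq> {..<H}" unfolding J_def H_def using q2 by auto
  have cJ: "real (card J) \<le> real q ^ 3 + 4 * real q ^ 2"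
  proof -
    have "card J \<le> q ^ 3 + 4 * q ^ 2"
      unfolding J_def by (rule order.trans[OF card_Un_le]) (use q2 in simp)
    then have "real (card J) \<le> real (q ^ 3 + 4 * q ^ 2)" by (simp only: of_nat_le_iff)
    then show ?thesis by simp
  qed
  \<comment> \<open>Here x and j / H are at least 1 / q apart modulo 1, so the geometric sum is at
    most q and its square at most q^2.\<close>
  have far: "dirichlet_weight H j x \<le> (real q)\<^sup>2" if "frac x < 1 / 2" "j \<in> {..<H} - J" for x j
  proof -
    have jj: "real j \<ge> real q ^ 3 + 2 * real q ^ 2" "real j \<le> 2 * real q ^ 3 - 2 * real q ^ 2"
    proof -
      have "q ^ 3 + 2 * q ^ 2 \<le> j" "j + 2 * q ^ 2 \<le> 2 * q ^ 3" using that q2 by (auto simp: J_def H_def)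
      then have "real (q ^ 3 + 2 * q ^ 2) \<le> real j" "real (j + 2 * q ^ 2) \<le> real (2 * q ^ 3)"
        by (simp_all only: of_nat_le_iff)
      then show "real j \<ge> real q ^ 3 + 2 * real q ^ 2" "real j \<le> 2 * real q ^ 3 - 2 * real q ^ 2" by simp_all
    qed
    define v where "v = real j / real H - frac x"
    have "1 / 2 + 1 / real q = (real q ^ 3 + 2 * real q ^ 2) / real H"
      using q unfolding H by (simp add: field_simps power3_eq_cube power2_eq_square)
    also have "\<dots> \<le> real j / real H" using jj H by (intro divide_right_mono) auto
    finally have "1 / 2 + 1 / real q \<le> real j / real H" .
    then have v1: "v \<ge> 1 / real q" using that by (simp add: v_def)
    have "real j / real H \<le> (2 * real q ^ 3 - 2 * real q ^ 2) / real H"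
      using jj H by (intro divide_right_mono) auto
    also have "\<dots> = 1 - 1 / real q"
      using q unfolding H by (simp add: field_simps power3_eq_cube power2_eq_square)
    finally have "real j / real H \<le> 1 - 1 / real q" .
    then have v2: "v \<le> 1 - 1 / real q" using frac_ge_0[of x] unfolding v_def by linarith
    have sv: "sin (pi * v) \<ge> 1 / real q"
    proof (cases "v \<le> 1 / 2")
      case True
      then show ?thesis using sin_pi_mult_ge[of v] v1 q by (smt (verit) of_nat_0_le_iff divide_nonneg_nonneg)
    next
      case False
      have "1 - v \<le> sin (pi * (1 - v))" using False v2 q by (intro sin_pi_mult_ge) (smt (verit) of_nat_0_le_iff divide_nonneg_nonneg, simp)
      also have "sin (pi * (1 - v)) = sin (pi * v)" by (simp add: right_diff_distrib)
      finally show ?thesis using v2 by simp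
    qed
    have "sin (pi * (x - real j / real H)) = sin (pi * of_int \<lfloor>x\<rfloor> - pi * v)"
      by (simp add: v_def frac_def algebra_simps)
    also have "\<bar>\<dots>\<bar> = \<bar>sin (pi * v)\<bar>"
    proof -
      have "sin (pi * of_int \<lfloor>x\<rfloor>) = 0" by (metis mult.commute sin_zero_iff_int2)
      moreover from this have "\<bar>cos (pi * of_int \<lfloor>x\<rfloor>)\<bar> = 1"
        using sin_cos_squared_add[of "pi * of_int \<lfloor>x\<rfloor>"] by (simp add: power2_eq_1_iff abs_if)
      ultimately show ?thesis by (simp add: sin_diff abs_mult)
    qed
    finally have "1 / real q \<le> \<bar>sin (pi * (x - real j / real H))\<bar>" using sv by linarith
    then have "norm (\<Sum>m<H. cis (2 * pi * (real m * (x - real j / real H)))) \<le> 1 / (1 / real q)"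
      using q by (intro norm_geometric_sum_cis_le) auto
    then show ?thesis unfolding dirichlet_weight_def using q by (intro power_mono) auto
  qed
  have point: "(real H)\<^sup>2 \<le> (\<Sum>j\<in>J. dirichlet_weight H j x) + real H * (real q)\<^sup>2" if "frac x < 1 / 2" for x
  proof -
    have "(real H)\<^sup>2 = (\<Sum>j\<in>J. dirichlet_weight H j x) + (\<Sum>j\<in>{..<H} - J. dirichlet_weight H j x)"
      using sum_dirichlet_weight[of H x] sum.subset_diff[OF JH, of "\<lambda>j. dirichlet_weight H j x"] by simp
    moreover have "(\<Sum>j\<in>{..<H} - J. dirichlet_weight H j x) \<le> (\<Sum>j\<in>{..<H} - J. (real q)\<^sup>2)"
      using far[OF that] by (intro sum_mono) auto
    moreover have "(\<Sum>j\<in>{..<H} - J. (real q)\<^sup>2) \<le> real H * (real q)\<^sup>2"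
      using card_mono[of "{..<H}" "{..<H} - J"] by (simp add: mult_right_mono)
    ultimately show ?thesis by linarith
  qed
  have w0: "0 \<le> dirichlet_weight H j x" for j x by (simp add: dirichlet_weight_def)
  have "real (card S) * (real H)\<^sup>2 = (\<Sum>n\<in>S. (real H)\<^sup>2)" by simp
  also have "\<dots> \<le> (\<Sum>n\<in>S. (\<Sum>j\<in>J. dirichlet_weight H j (X n)) + real H * (real q)\<^sup>2)"
    by (intro sum_mono point) (simp add: S_def)
  also have "\<dots> \<le> (\<Sum>n<M. (\<Sum>j\<in>J. dirichlet_weight H j (X n)) + real H * (real q)\<^sup>2)"
    using fS w0 by (intro sum_mono2) (auto intro!: add_nonneg_nonneg sum_nonneg)
  also have "\<dots> = (\<Sum>j\<in>J. \<Sum>n<M. dirichlet_weight H j (X n)) + real M * (real H * (real q)\<^sup>2)"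
    by (simp add: sum.distrib sum.swap[of _ J])
  also have "\<dots> \<le> (\<Sum>j\<in>J. real H * real M + 2 * (real H)\<^sup>2 * B) + real M * (real H * (real q)\<^sup>2)"
    using B B0 by (intro add_right_mono sum_mono sum_dirichlet_weight_sequence_le) (auto simp: H_def)
  also have "\<dots> = real H * real M * real (card J) + 2 * (real H)\<^sup>2 * B * real (card J) + real M * (real H * (real q)\<^sup>2)"
    by (simp add: algebra_simps)
  also have "\<dots> \<le> real H * real M * (real q ^ 3 + 4 * real q ^ 2) + 2 * (real H)\<^sup>2 * B * real H + real M * (real H * (real q)\<^sup>2)"
  proof (intro add_mono mult_left_mono cJ order.refl)
    show "real (card J) \<le> real H" using card_mono[OF _ JH] by simp
  qed (use B0 in auto)
  \<comment> \<open>After division by H^2 = 4 q^6 the indices in \<open>J\<close> contribute M / 2 +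
    2 M / q and the far ones M / (2 q); the coefficient 3 leaves a slack of M / (2 q).\<close>
  also have "\<dots> \<le> (real M / 2 + 3 * real M / real q + 4 * real q ^ 3 * B) * (real H)\<^sup>2"
  proof -
    have "(real M / 2 + 3 * real M / real q + 4 * real q ^ 3 * B) * (real H)\<^sup>2 -
      (real H * real M * (real q ^ 3 + 4 * real q ^ 2) + 2 * (real H)\<^sup>2 * B * real H + real M * (real H * (real q)\<^sup>2))
      = 2 * real M * real q ^ 5"
      unfolding H using q by (simp add: field_simps eval_nat_numeral)
    moreover have "0 \<le> 2 * real M * real q ^ 5" by simp
    ultimately show ?thesis by linarith
  qed
  finally show ?thesis using H(2) by (simp add: S_def)
qed

section \<open>Hardy fields\<close>

text \<open>Nonstrict inequalities keep the zero germ inside, so that a sign can be passed to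
  products and from a derivative to its function without singling that germ out.\<close>

definition weakly_signed :: "(real \<Rightarrow> real) \<Rightarrow> bool" where
  "weakly_signed w \<longleftrightarrow> (\<forall>\<^sub>F x in at_top. 0 \<le> w x) \<or> (\<forall>\<^sub>F x in at_top. w x \<le> 0)"

lemma weakly_signed_cong:
  assumes "weakly_signed v" "\<forall>\<^sub>F x in at_top. w x = v x"
  shows "weakly_signed w"
  using assms(1)[unfolded weakly_signed_def]
proof
  assume "\<forall>\<^sub>F x in at_top. 0 \<le> v x"
  with assms(2) have "\<forall>\<^sub>F x in at_top. 0 \<le> w x" by eventually_elim simp
  then show ?thesis by (simp add: weakly_signed_def)
next
  assume "\<forall>\<^sub>F x in at_top. v x \<le> 0"
  with assms(2) have "\<forall>\<^sub>F x in at_top. w x \<le> 0" by eventually_elim simp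
  then show ?thesis by (simp add: weakly_signed_def)
qed

lemma weakly_signed_mult:
  assumes "weakly_signed v" "weakly_signed w"
  shows "weakly_signed (\<lambda>x. v x * w x)"
  using assms[unfolded weakly_signed_def]
proof (elim disjE)
  assume "\<forall>\<^sub>F x in at_top. 0 \<le> v x" "\<forall>\<^sub>F x in at_top. 0 \<le> w x"
  then show ?thesis unfolding weakly_signed_def
    by (intro disjI1) (erule eventually_elim2, assumption, rule mult_nonneg_nonneg)
next
  assume "\<forall>\<^sub>F x in at_top. 0 \<le> v x" "\<forall>\<^sub>F x in at_top. w x \<le> 0"
  then show ?thesis unfolding weakly_signed_def
    by (intro disjI2) (erule eventually_elim2, assumption, rule mult_nonneg_nonpos)
next
  assume "\<forall>\<^sub>F x in at_top. v x \<le> 0" "\<forall>\<^sub>F x in at_top. 0 \<le> w x"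
  then show ?thesis unfolding weakly_signed_def
    by (intro disjI2) (erule eventually_elim2, assumption, rule mult_nonpos_nonneg)
next
  assume "\<forall>\<^sub>F x in at_top. v x \<le> 0" "\<forall>\<^sub>F x in at_top. w x \<le> 0"
  then show ?thesis unfolding weakly_signed_def
    by (intro disjI1) (erule eventually_elim2, assumption, rule mult_nonpos_nonpos)
qed

lemma weakly_signed_uminus: "weakly_signed w \<Longrightarrow> weakly_signed (\<lambda>x. - w x)"
  unfolding weakly_signed_def by auto

text \<open>A function that is nondecreasing from some point on either becomes nonnegative once, and
  then stays so, or remains negative.\<close>

lemma weakly_signed_of_nonneg_deriv:
  fixes w w' :: "real \<Rightarrow> real"
  assumes d: "\<forall>\<^sub>F x in at_top. (w has_real_derivative w' x) (at x)"
    and s: "\<forall>\<^sub>F x in at_top. 0 \<le> w' x"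
  shows "weakly_signed w"
proof -
  obtain x0 where x0: "\<And>x. x \<ge> x0 \<Longrightarrow> (w has_real_derivative w' x) (at x) \<and> 0 \<le> w' x"
    using eventually_conj[OF d s] by (auto simp: eventually_at_top_linorder)
  have mono: "w a \<le> w b" if "x0 \<le> a" "a \<le> b" for a b
    using that x0 by (intro DERIV_nonneg_imp_nondecreasing[of a b w]) (auto intro: order.trans)
  show ?thesis
  proof (cases "\<exists>a\<ge>x0. 0 \<le> w a")
    case True
    then obtain a where a: "a \<ge> x0" "0 \<le> w a" by blast
    then have "\<forall>x\<ge>a. 0 \<le> w x" using mono by force
    then show ?thesis unfolding weakly_signed_def eventually_at_top_linorder by blast
  next
    case False
    then have "\<forall>x\<ge>x0. w x \<le> 0" by force
    then show ?thesis unfolding weakly_signed_def eventually_at_top_linorder by blast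
  qed
qed

lemma weakly_signed_of_deriv:
  fixes w w' :: "real \<Rightarrow> real"
  assumes d: "\<forall>\<^sub>F x in at_top. (w has_real_derivative w' x) (at x)" and s: "weakly_signed w'"
  shows "weakly_signed w"
  using s unfolding weakly_signed_def[of w']
proof
  assume "\<forall>\<^sub>F x in at_top. 0 \<le> w' x"
  then show ?thesis by (rule weakly_signed_of_nonneg_deriv[OF d])
next
  assume "\<forall>\<^sub>F x in at_top. w' x \<le> 0"
  then have "\<forall>\<^sub>F x in at_top. 0 \<le> - w' x" by simp
  moreover have "\<forall>\<^sub>F x in at_top. ((\<lambda>x. - w x) has_real_derivative - w' x) (at x)"
    using d by (rule eventually_mono) (rule DERIV_minus)
  ultimately have "weakly_signed (\<lambda>x. - w x)" by (intro weakly_signed_of_nonneg_deriv)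
  from weakly_signed_uminus[OF this] show ?thesis by simp
qed

lemma weakly_signed_of_nonzero:
  fixes w w' :: "real \<Rightarrow> real"
  assumes "\<forall>\<^sub>F x in at_top. (w has_real_derivative w' x) (at x)" "\<forall>\<^sub>F x in at_top. w x \<noteq> 0"
  shows "weakly_signed w"
proof (rule ccontr)
  assume ns: "\<not> weakly_signed w"
  obtain x0 where x0: "\<And>x. x \<ge> x0 \<Longrightarrow> isCont w x \<and> w x \<noteq> 0"
    using eventually_conj[OF assms] by (auto simp: eventually_at_top_linorder intro: DERIV_isCont)
  from ns obtain a where a: "a \<ge> x0" "w a < 0"
    unfolding weakly_signed_def eventually_at_top_linorder by (metis linorder_not_le)
  from ns obtain b where b: "b \<ge> a" "w b > 0"
    unfolding weakly_signed_def eventually_at_top_linorder by (metis linorder_not_le)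
  have "\<exists>x\<ge>a. x \<le> b \<and> w x = 0"
    using a b x0 by (intro IVT) auto
  then show False using x0 a by fastforce
qed

section \<open>Sign and comparison with powers in a fixed Hardy field\<close>

locale hardy =
  fixes K :: "germ set"
  assumes hardy_field: "hardy_field K"
begin

definition mem :: "(real \<Rightarrow> real) \<Rightarrow> bool" where
  "mem h \<longleftrightarrow> germ_of h \<in> K"

lemma subfield_K: "subfield K germ_ring"
  using hardy_field by (simp add: hardy_field_def)

lemma subring_K: "subring K germ_ring"
  using subfieldE(1)[OF subfield_K] .

lemma germ_ring_ring: "ring germ_ring"
  using cring_germ_ring by (simp add: cring_def)

lemma mem_add: "mem g \<Longrightarrow> mem h \<Longrightarrow> mem (\<lambda>x. g x + h x)"
  using subringE(7)[OF subring_K, of "germ_of g" "germ_of h"]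
  by (simp add: mem_def germ_ring_def plus_germ.abs_eq)

lemma mem_mult: "mem g \<Longrightarrow> mem h \<Longrightarrow> mem (\<lambda>x. g x * h x)"
  using subringE(6)[OF subring_K, of "germ_of g" "germ_of h"]
  by (simp add: mem_def germ_ring_def times_germ.abs_eq)

lemma mem_one: "mem (\<lambda>x. 1)"
  using subringE(3)[OF subring_K]
  by (simp add: mem_def germ_ring_def one_germ.abs_eq)

lemma mem_zero: "mem (\<lambda>x. 0)"
  using subringE(2)[OF subring_K]
  by (simp add: mem_def germ_ring_def zero_germ.abs_eq)

text \<open>The field inverse transported to representatives: a nonzero germ is not merely nonzero
  at arbitrarily large points, it is eventually nowhere zero. Any function representing the inverse
  germ serves as \<open>r\<close>.\<close>

lemma mem_inverse:
  assumes "mem h"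
  shows "(\<forall>\<^sub>F x in at_top. h x = 0) \<or> (\<exists>r. mem r \<and> (\<forall>\<^sub>F x in at_top. h x * r x = 1))"
proof (cases "germ_of h = 0")
  case True
  then show ?thesis by (simp add: zero_germ.abs_eq germ.abs_eq_iff)
next
  case False
  then have "germ_of h \<in> K - {\<zero>\<^bsub>germ_ring\<^esub>}" using assms by (simp add: mem_def germ_ring_def)
  then have *: "inv\<^bsub>germ_ring\<^esub> germ_of h \<in> K" "germ_of h * inv\<^bsub>germ_ring\<^esub> germ_of h = 1"
    using ring.subfield_m_inv(1,2)[OF germ_ring_ring subfield_K] by (auto simp: germ_ring_def)
  obtain r where "inv\<^bsub>germ_ring\<^esub> germ_of h = germ_of r"
    using Quotient_abs_rep[OF Quotient_germ] by metis
  with * have "mem r" "germ_of h * germ_of r = 1" by (simp_all add: mem_def)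
  then show ?thesis
    by (auto simp: times_germ.abs_eq one_germ.abs_eq germ.abs_eq_iff)
qed

lemma mem_deriv:
  assumes "mem h"
  shows "\<exists>h'. mem h' \<and> (\<forall>\<^sub>F x in at_top. (h has_real_derivative h' x) (at x))"
  using assms hardy_field by (simp add: mem_def hardy_field_def)

lemma mem_of_nat: "mem (\<lambda>x. real n)"
proof (induction n)
  case (Suc n)
  from mem_add[OF this mem_one] show ?case by (simp add: add.commute)
qed (use mem_zero in simp)

lemma mem_uminus: "mem h \<Longrightarrow> mem (\<lambda>x. - h x)"
proof -
  assume "mem h"
  then have "\<ominus>\<^bsub>germ_ring\<^esub> germ_of h \<in> K"
    using subringE(5)[OF subring_K, of "germ_of h"] by (simp add: mem_def)
  moreover have "\<ominus>\<^bsub>germ_ring\<^esub> germ_of h = - germ_of h"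
  proof -
    interpret R: ring germ_ring by (rule germ_ring_ring)
    have "- germ_of h \<oplus>\<^bsub>germ_ring\<^esub> germ_of h = \<zero>\<^bsub>germ_ring\<^esub>" by (simp add: germ_ring_def)
    then show ?thesis using R.minus_equality[of "- germ_of h" "germ_of h"] by (simp add: germ_ring_def)
  qed
  ultimately show ?thesis by (simp add: mem_def uminus_germ.abs_eq)
qed

lemma mem_of_int: "mem (\<lambda>x. real_of_int n)"
proof (cases n rule: int_cases2)
  case (nonneg m) then show ?thesis using mem_of_nat[of m] by simp
next
  case (nonpos m) then show ?thesis using mem_uminus[OF mem_of_nat[of m]] by simp
qed

lemma mem_weakly_signed:
  assumes "mem h"
  shows "weakly_signed h"
  using mem_inverse[OF assms]
proof
  assume "\<forall>\<^sub>F x in at_top. h x = 0"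
  then have "\<forall>\<^sub>F x in at_top. 0 \<le> h x" by (rule eventually_mono) simp
  then show ?thesis by (simp add: weakly_signed_def)
next
  assume "\<exists>r. mem r \<and> (\<forall>\<^sub>F x in at_top. h x * r x = 1)"
  then obtain r where "\<forall>\<^sub>F x in at_top. h x * r x = 1" by blast
  then have "\<forall>\<^sub>F x in at_top. h x \<noteq> 0" by (rule eventually_mono) auto
  then show ?thesis using mem_deriv[OF assms] weakly_signed_of_nonzero by blast
qed

text \<open>This is the part of the statement that \<open>K(x)\<close> is again a Hardy field that is needed;
  \<open>K\<close> itself need not contain the germ of \<open>x\<close>.\<close>

lemma linear_weakly_signed:
  assumes "mem u" "mem v"
  shows "weakly_signed (\<lambda>x. u x * x + v x)"
  using mem_inverse[OF assms(1)]
proof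
  assume "\<forall>\<^sub>F x in at_top. u x = 0"
  then have "\<forall>\<^sub>F x in at_top. u x * x + v x = v x" by (rule eventually_mono) simp
  then show ?thesis by (rule weakly_signed_cong[OF mem_weakly_signed[OF assms(2)]])
next
  assume "\<exists>r. mem r \<and> (\<forall>\<^sub>F x in at_top. u x * r x = 1)"
  then obtain r where r: "mem r" "\<forall>\<^sub>F x in at_top. u x * r x = 1" by blast
  \<comment> \<open>Division by u leaves x + t with t = v / u. The derivative 1 + t' lies in K and
    therefore has a sign, even when the germ of x does not lie in K.\<close>
  define t where "t x = v x * r x" for x
  have "mem t" unfolding t_def using mem_mult[OF assms(2) r(1)] .
  then obtain t' where t': "mem t'" "\<forall>\<^sub>F x in at_top. (t has_real_derivative t' x) (at x)"
    using mem_deriv by blast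
  have "\<forall>\<^sub>F x in at_top. ((\<lambda>x. x + t x) has_real_derivative 1 + t' x) (at x)"
    using t'(2) by (rule eventually_mono) (auto intro!: derivative_eq_intros)
  then have "weakly_signed (\<lambda>x. x + t x)"
    using mem_weakly_signed[OF mem_add[OF mem_one t'(1)]] by (rule weakly_signed_of_deriv)
  then have "weakly_signed (\<lambda>x. u x * (x + t x))"
    using mem_weakly_signed[OF assms(1)] by (intro weakly_signed_mult)
  moreover have "\<forall>\<^sub>F x in at_top. u x * x + v x = u x * (x + t x)"
    using r(2)
  proof (rule eventually_mono)
    fix x assume "u x * r x = 1"
    then have "u x * t x = v x" unfolding t_def by (metis mult.left_commute mult.right_neutral)
    then show "u x * x + v x = u x * (x + t x)" by (simp add: distrib_left)
  qed
  ultimately show ?thesis by (rule weakly_signed_cong)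
qed

text \<open>The derivative of h x^(-p/q) is a positive function times q x h' - p h, whose
  coefficients q h' and - p h lie in K. A rational exponent is what keeps them there: arbitrary real
  constants need not belong to K.\<close>

lemma powr_ratio_minus_one_weakly_signed:
  fixes p :: int and q :: nat
  assumes "mem h" and q: "q > 0"
  shows "weakly_signed (\<lambda>x. h x * x powr (- (real_of_int p / real q)) - 1)"
proof -
  define c where "c = real_of_int p / real q"
  obtain h' where h': "mem h'" "\<forall>\<^sub>F x in at_top. (h has_real_derivative h' x) (at x)"
    using mem_deriv[OF assms(1)] by blast
  have "weakly_signed (\<lambda>x. (real q * h' x) * x + real_of_int (- p) * h x)"
    by (intro linear_weakly_signed mem_mult mem_of_nat mem_of_int h' assms)
  moreover have "weakly_signed (\<lambda>x. x powr (- c - 1) / real q)"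
    unfolding weakly_signed_def by (intro disjI1 always_eventually) simp
  ultimately have "weakly_signed (\<lambda>x. (x powr (- c - 1) / real q) * ((real q * h' x) * x + real_of_int (- p) * h x))"
    by (intro weakly_signed_mult)
  moreover have "\<forall>\<^sub>F x in at_top. ((\<lambda>x. h x * x powr (- c) - 1) has_real_derivative
     (x powr (- c - 1) / real q) * ((real q * h' x) * x + real_of_int (- p) * h x)) (at x)"
    using h'(2) eventually_gt_at_top[of 0]
  proof eventually_elim
    case (elim x)
    have "((\<lambda>x. h x * x powr (- c) - 1) has_real_derivative
        h' x * x powr (- c) + h x * (- c * x powr (- c - 1))) (at x)"
      using elim by (auto intro!: derivative_eq_intros has_real_derivative_powr)
    moreover have "x powr (- c) = x powr (- c - 1) * x" using elim by (simp add: powr_diff)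
    then have "h' x * x powr (- c) + h x * (- c * x powr (- c - 1)) =
      (x powr (- c - 1) / real q) * ((real q * h' x) * x + real_of_int (- p) * h x)"
      using q by (simp add: c_def field_simps)
    ultimately show ?case by simp
  qed
  ultimately show ?thesis unfolding c_def by (rule weakly_signed_of_deriv[rotated])
qed

lemma compare_powr:
  fixes p :: int and q :: nat
  assumes "mem h" and q: "q > 0"
  shows "(\<forall>\<^sub>F x in at_top. x powr (real_of_int p / real q) \<le> \<bar>h x\<bar>) \<or>
         (\<forall>\<^sub>F x in at_top. \<bar>h x\<bar> \<le> x powr (real_of_int p / real q))"
proof -
  define c where "c = real_of_int p / real q"
  have main: "(\<forall>\<^sub>F x in at_top. x powr c \<le> \<bar>g x\<bar>) \<or> (\<forall>\<^sub>F x in at_top. \<bar>g x\<bar> \<le> x powr c)"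
    if g: "mem g" "\<forall>\<^sub>F x in at_top. 0 \<le> g x" for g
    using powr_ratio_minus_one_weakly_signed[OF g(1) q, of p] unfolding c_def[symmetric] weakly_signed_def
  proof
    assume "\<forall>\<^sub>F x in at_top. 0 \<le> g x * x powr (- c) - 1"
    then have "\<forall>\<^sub>F x in at_top. x powr c \<le> \<bar>g x\<bar>"
      using eventually_gt_at_top[of 0] g(2)
      by eventually_elim (simp add: powr_minus field_simps)
    then show ?thesis ..
  next
    assume "\<forall>\<^sub>F x in at_top. g x * x powr (- c) - 1 \<le> 0"
    then have "\<forall>\<^sub>F x in at_top. \<bar>g x\<bar> \<le> x powr c"
      using eventually_gt_at_top[of 0] g(2)
      by eventually_elim (simp add: powr_minus field_simps)
    then show ?thesis ..
  qed
  show ?thesis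
    using mem_weakly_signed[OF assms(1)] main[OF assms(1)] main[OF mem_uminus[OF assms(1)]]
    unfolding weakly_signed_def c_def by auto
qed

text \<open>Membership provides a derivative only near infinity, with a threshold that may grow with
  i, so the chain is built by dependent choice; finitely many members are later made valid from a
  common point on.\<close>

lemma mem_iterated_deriv:
  assumes "mem f"
  shows "\<exists>g. g 0 = f \<and> (\<forall>i. mem (g i)) \<and>
     (\<forall>i. \<forall>\<^sub>F x in at_top. (g i has_real_derivative g (Suc i) x) (at x))"
proof -
  have "\<exists>g. \<forall>n. (mem (g n) \<and> (n = 0 \<longrightarrow> g n = f)) \<and>
     (\<forall>\<^sub>F x in at_top. (g n has_real_derivative g (Suc n) x) (at x))"
  proof (rule dependent_nat_choice)
    show "\<exists>h. mem h \<and> (0 = 0 \<longrightarrow> h = f)" using assms by blast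
    show "\<exists>y. (mem y \<and> (Suc n = 0 \<longrightarrow> y = f)) \<and> (\<forall>\<^sub>F x in at_top. (h has_real_derivative y x) (at x))"
      if "mem h \<and> (n = 0 \<longrightarrow> h = f)" for h :: "real \<Rightarrow> real" and n :: nat
      using mem_deriv that by simp
  qed
  then show ?thesis by blast
qed

end

section \<open>Size of the derivatives\<close>

lemma abs_diff_le_of_deriv_le:
  fixes h h' P P' :: "real \<Rightarrow> real"
  assumes "\<And>t. x \<le> t \<Longrightarrow> (h has_real_derivative h' t) (at t)"
    and "\<And>t. x \<le> t \<Longrightarrow> (P has_real_derivative P' t) (at t)"
    and "\<And>t. x \<le> t \<Longrightarrow> \<bar>h' t\<bar> \<le> P' t" and "x \<le> y"
  shows "\<bar>h y - h x\<bar> \<le> P y - P x"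
proof -
  have "(\<lambda>t. P t - h t) x \<le> (\<lambda>t. P t - h t) y"
  proof (rule DERIV_nonneg_imp_nondecreasing[OF \<open>x \<le> y\<close>])
    fix t assume "x \<le> t" "t \<le> y"
    then show "\<exists>d. ((\<lambda>t. P t - h t) has_real_derivative d) (at t) \<and> d \<ge> 0"
      using assms(1-3)[of t] by (intro exI[of _ "P' t - h' t"]) (auto intro!: DERIV_diff)
  qed
  moreover have "(\<lambda>t. P t + h t) x \<le> (\<lambda>t. P t + h t) y"
  proof (rule DERIV_nonneg_imp_nondecreasing[OF \<open>x \<le> y\<close>])
    fix t assume "x \<le> t" "t \<le> y"
    then show "\<exists>d. ((\<lambda>t. P t + h t) has_real_derivative d) (at t) \<and> d \<ge> 0"
      using assms(1-3)[of t] by (intro exI[of _ "P' t + h' t"]) (auto intro!: DERIV_add)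
  qed
  ultimately show ?thesis by (simp add: abs_le_iff)
qed

lemma powr_antiderivative:
  fixes t :: real
  assumes "a \<noteq> -1" "0 < t"
  shows "((\<lambda>t. C * t powr (a + 1) / (a + 1)) has_real_derivative C * t powr a) (at t)"
proof -
  have "((\<lambda>t. t powr (a + 1)) has_real_derivative (a + 1) * t powr (a + 1 - 1)) (at t)"
    using assms by (intro has_real_derivative_powr) auto
  from DERIV_cmult[OF this, of "C / (a + 1)"] show ?thesis using assms by simp
qed

lemma eventually_abs_diff_le_powr:
  fixes h h' :: "real \<Rightarrow> real"
  assumes "\<forall>\<^sub>F x in at_top. (h has_real_derivative h' x) (at x)"
    and "\<forall>\<^sub>F x in at_top. \<bar>h' x\<bar> \<le> C * x powr a" and "a \<noteq> -1"
  obtains x0 where "x0 \<ge> 1" "\<And>x y. x0 \<le> x \<Longrightarrow> x \<le> y \<Longrightarrow>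
    \<bar>h y - h x\<bar> \<le> C * y powr (a + 1) / (a + 1) - C * x powr (a + 1) / (a + 1)"
proof -
  from eventually_conj[OF assms(1,2)] obtain x1 where
    x1: "\<And>x. x \<ge> x1 \<Longrightarrow> (h has_real_derivative h' x) (at x) \<and> \<bar>h' x\<bar> \<le> C * x powr a"
    by (auto simp: eventually_at_top_linorder)
  show ?thesis
  proof (rule that[of "max 1 x1"])
    fix x y assume xy: "max 1 x1 \<le> x" "x \<le> (y::real)"
    then show "\<bar>h y - h x\<bar> \<le> C * y powr (a + 1) / (a + 1) - C * x powr (a + 1) / (a + 1)"
      using x1 assms(3)
      by (intro abs_diff_le_of_deriv_le[of x h h' "\<lambda>t. C * t powr (a + 1) / (a + 1)" "\<lambda>t. C * t powr a"]
          powr_antiderivative) auto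
  qed simp
qed

lemma integrate_powr_upper:
  fixes h h' :: "real \<Rightarrow> real"
  assumes d: "\<forall>\<^sub>F x in at_top. (h has_real_derivative h' x) (at x)"
    and b: "\<forall>\<^sub>F x in at_top. \<bar>h' x\<bar> \<le> C * x powr a" and a: "a > -1"
  shows "\<exists>C'. \<forall>\<^sub>F x in at_top. \<bar>h x\<bar> \<le> C' * x powr (a + 1)"
proof -
  obtain x0 where x0: "x0 \<ge> 1" "\<And>x y. x0 \<le> x \<Longrightarrow> x \<le> y \<Longrightarrow>
    \<bar>h y - h x\<bar> \<le> C * y powr (a + 1) / (a + 1) - C * x powr (a + 1) / (a + 1)"
    using eventually_abs_diff_le_powr[OF d b] a by auto
  define D where "D = \<bar>h x0\<bar> + \<bar>C * x0 powr (a + 1) / (a + 1)\<bar>"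
  have "\<bar>h x\<bar> \<le> (C / (a + 1) + D) * x powr (a + 1)" if "x \<ge> x0" for x
  proof -
    have "x powr (a + 1) \<ge> 1" using that x0(1) a by (intro ge_one_powr_ge_zero) auto
    then have "D * 1 \<le> D * x powr (a + 1)" by (intro mult_left_mono) (auto simp: D_def)
    moreover have "\<bar>h x\<bar> \<le> C * x powr (a + 1) / (a + 1) + D"
      using x0(2)[of x0 x] that unfolding D_def by linarith
    ultimately show ?thesis by (simp add: algebra_simps)
  qed
  then show ?thesis by (auto simp: eventually_at_top_linorder)
qed

lemma integrate_powr_lower:
  fixes h h' :: "real \<Rightarrow> real"
  assumes d: "\<forall>\<^sub>F x in at_top. (h has_real_derivative h' x) (at x)"
    and b: "\<forall>\<^sub>F x in at_top. c * x powr a \<le> h' x" and a: "a > -1" and c: "c > 0"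
  shows "\<exists>c'>0. \<forall>\<^sub>F x in at_top. c' * x powr (a + 1) \<le> h x"
proof -
  from eventually_conj[OF d b] obtain x1 where
    x1: "\<And>x. x \<ge> x1 \<Longrightarrow> (h has_real_derivative h' x) (at x) \<and> c * x powr a \<le> h' x"
    by (auto simp: eventually_at_top_linorder)
  define x0 where "x0 = max 1 x1"
  let ?P = "\<lambda>t. c * t powr (a + 1) / (a + 1)"
  have mono: "h x0 - ?P x0 \<le> h x - ?P x" if "x0 \<le> x" for x
  proof (rule DERIV_nonneg_imp_nondecreasing[OF that])
    fix t assume t: "x0 \<le> t" "t \<le> x"
    then have "(h has_real_derivative h' t) (at t)" "c * t powr a \<le> h' t" "0 < t"
      using x1[of t] by (auto simp: x0_def)
    then show "\<exists>d. ((\<lambda>t. h t - ?P t) has_real_derivative d) (at t) \<and> d \<ge> 0"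
      using a by (intro exI[of _ "h' t - c * t powr a"]) (auto intro!: DERIV_diff powr_antiderivative)
  qed
  \<comment> \<open>Half of the constant c / (a + 1) given by integration; the other half absorbs
    the constant of integration for large x.\<close>
  define c' where "c' = c / (a + 1) / 2"
  have c': "c' > 0" using a c by (simp add: c'_def)
  have "filterlim (\<lambda>x::real. x powr (a + 1)) at_top at_top" using a by real_asymp
  then have "\<forall>\<^sub>F x in at_top. (- (h x0 - ?P x0)) / c' \<le> x powr (a + 1)"
    by (simp add: filterlim_at_top)
  then have "\<forall>\<^sub>F x in at_top. c' * x powr (a + 1) \<le> h x"
    using eventually_ge_at_top[of x0]
  proof eventually_elim
    case (elim x)
    then have "- (h x0 - ?P x0) \<le> c' * x powr (a + 1)" using c' by (simp add: field_simps)
    moreover have "?P x = 2 * (c' * x powr (a + 1))" using a by (simp add: c'_def field_simps)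
    ultimately show ?case using mono[OF elim(2)] by linarith
  qed
  then show ?thesis using c' by blast
qed

lemma integrate_powr_lower_abs:
  fixes h h' :: "real \<Rightarrow> real"
  assumes d: "\<forall>\<^sub>F x in at_top. (h has_real_derivative h' x) (at x)" and s: "weakly_signed h'"
    and b: "\<forall>\<^sub>F x in at_top. c * x powr a \<le> \<bar>h' x\<bar>" and a: "a > -1" and c: "c > 0"
  shows "\<exists>c'>0. \<forall>\<^sub>F x in at_top. c' * x powr (a + 1) \<le> \<bar>h x\<bar>"
  using s[unfolded weakly_signed_def]
proof
  assume "\<forall>\<^sub>F x in at_top. 0 \<le> h' x"
  with b have "\<forall>\<^sub>F x in at_top. c * x powr a \<le> h' x" by eventually_elim simp
  then obtain c' where c': "c' > 0" "\<forall>\<^sub>F x in at_top. c' * x powr (a + 1) \<le> h x"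
    using integrate_powr_lower[OF d _ a c] by blast
  from c'(2) have "\<forall>\<^sub>F x in at_top. c' * x powr (a + 1) \<le> \<bar>h x\<bar>" by eventually_elim simp
  then show ?thesis using c'(1) by blast
next
  assume "\<forall>\<^sub>F x in at_top. h' x \<le> 0"
  with b have *: "\<forall>\<^sub>F x in at_top. c * x powr a \<le> - h' x" by eventually_elim simp
  have "\<forall>\<^sub>F x in at_top. ((\<lambda>x. - h x) has_real_derivative - h' x) (at x)"
    using d by (rule eventually_mono) (rule DERIV_minus)
  then obtain c' where c': "c' > 0" "\<forall>\<^sub>F x in at_top. c' * x powr (a + 1) \<le> - h x"
    using integrate_powr_lower[OF _ * a c] by blast
  from c'(2) have "\<forall>\<^sub>F x in at_top. c' * x powr (a + 1) \<le> \<bar>h x\<bar>" by eventually_elim simp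
  then show ?thesis using c'(1) by blast
qed

text \<open>The function \<open>h\<close> converges here; the two alternatives of the first claim are that its limit
  is zero or not.\<close>

lemma integrate_powr_convergent:
  fixes h h' :: "real \<Rightarrow> real"
  assumes d: "\<forall>\<^sub>F x in at_top. (h has_real_derivative h' x) (at x)"
    and b: "\<forall>\<^sub>F x in at_top. \<bar>h' x\<bar> \<le> C * x powr a" and a: "a < -1" and C: "C > 0"
  shows "(\<exists>C'>0. \<forall>\<^sub>F x in at_top. \<bar>h x\<bar> \<le> C' * x powr (a + 1)) \<or>
         (\<exists>c>0. \<forall>\<^sub>F x in at_top. c \<le> \<bar>h x\<bar>)"
    and "\<exists>C'. \<forall>\<^sub>F x in at_top. \<bar>h x\<bar> \<le> C'"
proof -
  obtain x0 where x0: "x0 \<ge> 1" "\<And>x y. x0 \<le> x \<Longrightarrow> x \<le> y \<Longrightarrow>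
    \<bar>h y - h x\<bar> \<le> C * y powr (a + 1) / (a + 1) - C * x powr (a + 1) / (a + 1)"
    using eventually_abs_diff_le_powr[OF d b] a by auto
  define D where "D = C / (- a - 1)"
  have D: "D > 0" using a C by (simp add: D_def)
  have diff: "\<bar>h y - h x\<bar> \<le> D * x powr (a + 1)" if "x0 \<le> x" "x \<le> y" for x y
  proof -
    have "C * y powr (a + 1) / (a + 1) \<le> 0"
      using a C by (intro divide_nonneg_neg) auto
    moreover have "- (C * x powr (a + 1) / (a + 1)) = D * x powr (a + 1)"
      using a by (simp add: D_def field_simps)
    ultimately show ?thesis using x0(2)[OF that] by linarith
  qed
  show "\<exists>C'. \<forall>\<^sub>F x in at_top. \<bar>h x\<bar> \<le> C'"
  proof (intro exI)
    show "\<forall>\<^sub>F x in at_top. \<bar>h x\<bar> \<le> \<bar>h x0\<bar> + D * x0 powr (a + 1)"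
      using eventually_ge_at_top[of x0]
    proof eventually_elim
      case (elim x)
      then show ?case using diff[of x0 x] by linarith
    qed
  qed
  show "(\<exists>C'>0. \<forall>\<^sub>F x in at_top. \<bar>h x\<bar> \<le> C' * x powr (a + 1)) \<or>
         (\<exists>c>0. \<forall>\<^sub>F x in at_top. c \<le> \<bar>h x\<bar>)"
  \<comment> \<open>\<open>D * x powr (a + 1)\<close> bounds the variation of h beyond x. If |h|
    somewhere exceeds twice this quantity, it can never come back to zero; otherwise the decay bound
    holds everywhere. The limit itself is not constructed.\<close>
  proof (cases "\<exists>x1\<ge>x0. 2 * (D * x1 powr (a + 1)) < \<bar>h x1\<bar>")
    case True
    then obtain x1 where x1: "x1 \<ge> x0" "2 * (D * x1 powr (a + 1)) < \<bar>h x1\<bar>" by blast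
    have "\<forall>\<^sub>F x in at_top. D * x1 powr (a + 1) \<le> \<bar>h x\<bar>"
      using eventually_ge_at_top[of x1]
    proof eventually_elim
      case (elim x)
      then show ?case using diff[of x1 x] x1 by linarith
    qed
    moreover have "D * x1 powr (a + 1) > 0" using D x0(1) x1(1) by auto
    ultimately show ?thesis by blast
  next
    case False
    then have "\<forall>x\<ge>x0. \<bar>h x\<bar> \<le> (2 * D) * x powr (a + 1)" by (auto simp: not_less mult.assoc)
    then have "\<forall>\<^sub>F x in at_top. \<bar>h x\<bar> \<le> (2 * D) * x powr (a + 1)"
      by (auto simp: eventually_at_top_linorder)
    then show ?thesis using D by (intro disjI1 exI[of _ "2 * D"]) auto
  qed
qed

lemma iterated_upper:
  assumes g: "\<And>i. \<forall>\<^sub>F x in at_top. (g i has_real_derivative g (Suc i) x) (at x)"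
    and "\<forall>\<^sub>F x in at_top. \<bar>g j x\<bar> \<le> C * x powr a" "a > -1"
  shows "\<exists>C'. \<forall>\<^sub>F x in at_top. \<bar>g 0 x\<bar> \<le> C' * x powr (a + real j)"
  using assms(2-)
proof (induction j arbitrary: a C)
  case 0
  then show ?case by auto
next
  case (Suc j)
  obtain C' where "\<forall>\<^sub>F x in at_top. \<bar>g j x\<bar> \<le> C' * x powr (a + 1)"
    using integrate_powr_upper[OF g[of j] Suc.prems(1,2)] by blast
  from Suc.IH[OF this] Suc.prems(2) show ?case by (simp add: add_ac)
qed

lemma not_growth_less_power:
  assumes "growth_less f (\<lambda>x. x ^ p)" "c > 0" "real p \<le> a"
  shows "\<not> (\<forall>\<^sub>F x in at_top. c * x powr a \<le> \<bar>f x\<bar>)"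
proof
  assume *: "\<forall>\<^sub>F x in at_top. c * x powr a \<le> \<bar>f x\<bar>"
  have "((\<lambda>x. f x / x ^ p) \<longlongrightarrow> 0) at_top" using assms(1) by (simp add: growth_less_def)
  then have "\<forall>\<^sub>F x in at_top. \<bar>f x / x ^ p\<bar> < c"
    using assms(2) by (auto simp: tendsto_iff dist_real_def)
  with * have "\<forall>\<^sub>F x::real in at_top. False"
    using eventually_ge_at_top[of 1]
  proof eventually_elim
    case (elim x)
    have "c * x ^ p = c * x powr real p" using elim by (simp add: powr_realpow)
    also have "\<dots> \<le> c * x powr a" using elim assms by (intro mult_left_mono powr_mono) auto
    also have "\<dots> \<le> \<bar>f x\<bar>" using elim by simp
    also have "\<dots> < c * x ^ p" using elim by (simp add: field_simps)
    finally show ?case by simp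
  qed
  then show False by simp
qed

lemma not_bounded_by_power:
  assumes "growth_less (\<lambda>x. x ^ p) f"
  shows "\<not> (\<forall>\<^sub>F x in at_top. \<bar>f x\<bar> \<le> C * x powr real p)"
proof
  assume *: "\<forall>\<^sub>F x in at_top. \<bar>f x\<bar> \<le> C * x powr real p"
  have nz: "\<forall>\<^sub>F x in at_top. f x \<noteq> 0" and "((\<lambda>x. x ^ p / f x) \<longlongrightarrow> 0) at_top"
    using assms by (simp_all add: growth_less_def)
  then have "\<forall>\<^sub>F x in at_top. \<bar>x ^ p / f x\<bar> < 1 / (\<bar>C\<bar> + 1)"
    by (auto simp: tendsto_iff dist_real_def)
  with * nz have "\<forall>\<^sub>F x::real in at_top. False"
    using eventually_ge_at_top[of 1]
  proof eventually_elim
    case (elim x)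
    then have "x ^ p * (\<bar>C\<bar> + 1) < \<bar>f x\<bar>" by (simp add: field_simps)
    also have "\<dots> \<le> C * x ^ p" using elim by (simp add: powr_realpow)
    also have "\<dots> \<le> x ^ p * (\<bar>C\<bar> + 1)" using elim by (simp add: mult.commute mult_left_mono)
    finally show ?case by simp
  qed
  then show False by simp
qed

lemma growth_exponent_le:
  assumes "\<forall>\<^sub>F x in at_top. \<bar>f x\<bar> \<le> C * x powr a" "a < b" "0 \<le> b"
  shows "growth_exponent f \<le> ereal b"
proof -
  have "((\<lambda>x. f x / x powr b) \<longlongrightarrow> 0) at_top"
  proof (rule Lim_null_comparison)
    show "\<forall>\<^sub>F x in at_top. norm (f x / x powr b) \<le> C * x powr (a - b)"
      using assms(1) eventually_gt_at_top[of 0]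
      by eventually_elim (simp add: powr_diff field_simps)
    show "((\<lambda>x. C * x powr (a - b)) \<longlongrightarrow> 0) at_top" using assms(2) by real_asymp
  qed
  moreover have "\<forall>\<^sub>F x in at_top. x powr b \<noteq> (0::real)"
    using eventually_gt_at_top[of 0] by eventually_elim simp
  ultimately have "growth_less f (\<lambda>x. x powr b)" by (simp add: growth_less_def)
  then show ?thesis unfolding growth_exponent_def using assms(3) by (intro INF_lower) auto
qed

context hardy
begin

text \<open>A lower bound on an absolute value can be integrated only if the integrand keeps its
  sign, which membership in the Hardy field guarantees at each of the j stages.\<close>

lemma iterated_lower:
  assumes g: "\<And>i. mem (g i)" "\<And>i. \<forall>\<^sub>F x in at_top. (g i has_real_derivative g (Suc i) x) (at x)"
    and "c > 0" "\<forall>\<^sub>F x in at_top. c * x powr a \<le> \<bar>g j x\<bar>" "a > -1"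
  shows "\<exists>c'>0. \<forall>\<^sub>F x in at_top. c' * x powr (a + real j) \<le> \<bar>g 0 x\<bar>"
  using assms(3-)
proof (induction j arbitrary: a c)
  case 0
  then show ?case by auto
next
  case (Suc j)
  obtain c' where "c' > 0" "\<forall>\<^sub>F x in at_top. c' * x powr (a + 1) \<le> \<bar>g j x\<bar>"
    using integrate_powr_lower_abs[OF g(2)[of j] mem_weakly_signed[OF g(1)] Suc.prems(2,3,1)] by blast
  from Suc.IH[OF this] Suc.prems(3) show ?case by (simp add: add_ac)
qed

text \<open>Integrating l + 2 times would give |f| at least a multiple of x^(l + 3/2), against f
  \<prec> x^(l+1). The number - 1 / 2 is one choice between - 1, above which integration raises the
  power, and 0, below which the block argument needs c.\<close>

lemma deriv_not_large:
  assumes g: "\<And>i. mem (g i)" "\<And>i. \<forall>\<^sub>F x in at_top. (g i has_real_derivative g (Suc i) x) (at x)"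
    and t: "of_type_power_plus l (g 0)"
  shows "\<not> (\<forall>\<^sub>F x in at_top. x powr (- 1 / 2) \<le> \<bar>g (l + 2) x\<bar>)"
proof
  assume "\<forall>\<^sub>F x in at_top. x powr (- 1 / 2) \<le> \<bar>g (l + 2) x\<bar>"
  then obtain c' where "c' > 0" "\<forall>\<^sub>F x in at_top. c' * x powr (- 1 / 2 + real (l + 2)) \<le> \<bar>g 0 x\<bar>"
    using iterated_lower[of g 1 "- 1 / 2" "l + 2", OF g] by auto
  moreover have "growth_less (g 0) (\<lambda>x. x ^ (l + 1))" using t by (simp add: of_type_power_plus_def)
  ultimately show False
    using not_growth_less_power[of "g 0" "l + 1" c' "- 1 / 2 + real (l + 2)"] by simp
qed

text \<open>Otherwise the derivative of order l + 1 either stays away from zero, so that f is at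
  least a multiple of x^(l+1), or is O(x^(a+1)). For l = 0 the latter integrates to f = O(x^(1/m))
  and contradicts the growth exponent. For l \<ge> 1 it is integrable at infinity, so the derivative
  of order l is bounded and f = O(x^l).\<close>

lemma deriv_lower_bound:
  assumes g: "\<And>i. mem (g i)" "\<And>i. \<forall>\<^sub>F x in at_top. (g i has_real_derivative g (Suc i) x) (at x)"
    and t: "of_type_power_plus l (g 0)"
  obtains m :: nat where "m \<ge> 2"
    "\<forall>\<^sub>F x in at_top. x powr (- real (l + 2) + 1 / real m) \<le> \<bar>g (l + 2) x\<bar>"
proof -
  have lo: "growth_less (\<lambda>x. x ^ l) (g 0)" and up: "growth_less (g 0) (\<lambda>x. x ^ (l + 1))"
    and ex: "growth_exponent (g 0) > 0" using t by (simp_all add: of_type_power_plus_def)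
  obtain b where b: "0 < ereal b" "ereal b < growth_exponent (g 0)"
    using ereal_dense2[OF ex] by blast
  \<comment> \<open>The choice 2 / m \<le> b leaves a strict margin: f = O(x^(1/m)) gives growth
    exponent at most 2 / m, which is below its true value.\<close>
  define m :: nat where "m = max 2 (nat \<lceil>2 / b\<rceil>)"
  have m: "m \<ge> 2" "2 / real m \<le> b"
  proof -
    have "2 / b \<le> real m" unfolding m_def by linarith
    then show "2 / real m \<le> b" using b by (simp add: m_def field_simps)
  qed (simp add: m_def)
  define a where "a = - real (l + 2) + 1 / real m"
  have m1: "1 / real m \<le> 1 / 2" "1 / real m > 0" using m(1) by (simp_all add: field_simps)
  have a: "a < -1" using m1 of_nat_0_le_iff[of l, where 'a = real] unfolding a_def of_nat_add by linarith
  have eq: "real_of_int (1 - int (l + 2) * int m) / real m = a"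
    using m(1) by (simp add: a_def field_simps)
  show ?thesis
  proof (rule that[OF m(1)], rule ccontr)
    assume "\<not> (\<forall>\<^sub>F x in at_top. x powr (- real (l + 2) + 1 / real m) \<le> \<bar>g (l + 2) x\<bar>)"
    then have "\<forall>\<^sub>F x in at_top. \<bar>g (l + 2) x\<bar> \<le> 1 * x powr a"
      using compare_powr[OF g(1)[of "l + 2"], of m "1 - int (l + 2) * int m"] m(1)
      unfolding eq a_def by auto
    from integrate_powr_convergent(1)[of "g (l + 1)", OF _ this a] g(2)[of "l + 1"]
    show False
    proof (auto, goal_cases)
      case (1 C')
      have 1: "\<forall>\<^sub>F x in at_top. \<bar>g (l + 1) x\<bar> \<le> C' * x powr (a + 1)" "C' > 0" using 1 by auto
      show False
      proof (cases "l = 0")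
        case True
        have "\<exists>C'. \<forall>\<^sub>F x in at_top. \<bar>g 0 x\<bar> \<le> C' * x powr (a + 1 + real (l + 1))"
          using g(2) 1 by (rule_tac iterated_upper) (use m1 True in \<open>auto simp: a_def\<close>)
        then obtain C2 where "\<forall>\<^sub>F x in at_top. \<bar>g 0 x\<bar> \<le> C2 * x powr (a + 1 + real (l + 1))" by blast
        moreover have "a + 1 + real (l + 1) = 1 / real m" by (simp add: a_def)
        ultimately have "growth_exponent (g 0) \<le> ereal (2 / real m)"
          using growth_exponent_le[of "g 0" C2 "1 / real m" "2 / real m"] m(1) by (simp add: divide_strict_right_mono)
        then show False using b m(2) by (metis ereal_less_eq(3) leD order.trans)
      next
        case False
        then have "1 \<le> real l" by simp
        then have a1: "a + 1 < - 1" using m1 unfolding a_def of_nat_add by linarith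
        obtain C2 where "\<forall>\<^sub>F x in at_top. \<bar>g l x\<bar> \<le> C2"
          using integrate_powr_convergent(2)[of "g l", OF _ 1(1) a1 1(2)] g(2)[of l] by auto
        then have "\<forall>\<^sub>F x in at_top. \<bar>g l x\<bar> \<le> C2 * x powr 0"
          using eventually_gt_at_top[of 0] by eventually_elim simp
        then obtain C3 where "\<forall>\<^sub>F x in at_top. \<bar>g 0 x\<bar> \<le> C3 * x powr (0 + real l)"
          using iterated_upper[of g l C2 0] g(2) by auto
        then show False using not_bounded_by_power[OF lo] by simp
      qed
    next
      case (2 c)
      then have "\<forall>\<^sub>F x in at_top. c * x powr 0 \<le> \<bar>g (l + 1) x\<bar>"
        using eventually_gt_at_top[of 0] by (auto elim: eventually_elim2)
      then obtain c' where "c' > 0" "\<forall>\<^sub>F x in at_top. c' * x powr (0 + real (l + 1)) \<le> \<bar>g 0 x\<bar>"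
        using iterated_lower[of g c 0 "l + 1"] g \<open>0 < c\<close> by auto
      then show False using not_growth_less_power[OF up, of c' "0 + real (l + 1)"] by simp
    qed
  qed
qed

text \<open>The exponents form a grid with mesh 1 / r starting at the known lower bound. At the last
  index before the lower bound by x^(e i) first fails, \<open>compare_powr\<close> supplies the
  opposite inequality at the next grid point. Failure does occur, because the grid passes - 1 /
  2.\<close>

lemma deriv_exponent:
  assumes g: "\<And>i. mem (g i)" "\<And>i. \<forall>\<^sub>F x in at_top. (g i has_real_derivative g (Suc i) x) (at x)"
    and t: "of_type_power_plus l (g 0)"
    and m: "m \<ge> 2" "\<forall>\<^sub>F x in at_top. x powr (- real (l + 2) + 1 / real m) \<le> \<bar>g (l + 2) x\<bar>"
    and r: "r > (0::nat)"
  obtains c where "- real (l + 2) + 1 / real m \<le> c" "c < - 1 / 2"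
    "\<forall>\<^sub>F x in at_top. x powr c \<le> \<bar>g (l + 2) x\<bar>" "\<forall>\<^sub>F x in at_top. \<bar>g (l + 2) x\<bar> \<le> x powr (c + 1 / real r)"
proof -
  define k where "k = l + 2"
  define e where "e i = - real k + 1 / real m + real i / real r" for i :: nat
  define P where "P i \<longleftrightarrow> (\<forall>\<^sub>F x in at_top. x powr e i \<le> \<bar>g k x\<bar>)" for i
  have big: "e i < - 1 / 2" if "P i" for i
  proof (rule ccontr)
    assume "\<not> e i < - 1 / 2"
    then have ei: "- 1 / 2 \<le> e i" by simp
    have "\<forall>\<^sub>F x in at_top. x powr (- 1 / 2) \<le> \<bar>g k x\<bar>"
      using that[unfolded P_def] eventually_ge_at_top[of 1]
    proof eventually_elim
      case (elim x)
      then show ?case using powr_mono[OF ei, of x] by linarith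
    qed
    then show False using deriv_not_large[of g l, OF g t] by (simp add: k_def)
  qed
  have "e (k * r) = 1 / real m" using r by (simp add: e_def)
  moreover have "0 \<le> 1 / real m" by simp
  ultimately have nP: "\<not> P (k * r)" using big[of "k * r"] by linarith
  have P0: "P 0" using m(2) by (simp add: P_def e_def k_def)
  obtain i where i: "P i" "\<not> P (Suc i)"
    using nP P0 by (metis nat_induct)
  have e_Suc: "e (Suc i) = e i + 1 / real r" by (simp add: e_def add_divide_distrib)
  have eq: "real_of_int (- int (k * m * r) + int r + int (Suc i) * int m) / real (m * r) = e (Suc i)"
    using r m(1) by (simp add: e_def field_simps)
  have "\<forall>\<^sub>F x in at_top. \<bar>g k x\<bar> \<le> x powr e (Suc i)"
    using compare_powr[OF g(1)[of k], of "m * r" "- int (k * m * r) + int r + int (Suc i) * int m"] i(2) r m(1)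
    unfolding eq P_def by auto
  then show ?thesis
    using i(1) big[OF i(1)] unfolding P_def e_Suc k_def
    by (intro that[of "e i"]) (simp_all add: e_def[of i] k_def)
qed

end

section \<open>Sums along arithmetic progressions\<close>

lemma frac_add_half_less_half_iff: "frac (x + 1 / 2) < 1 / 2 \<longleftrightarrow> \<not> frac x < (1 / 2 :: real)"
proof -
  have "frac (1 / 2 :: real) = 1 / 2" by (simp add: frac_eq)
  then have "frac (x + 1 / 2) = (if frac x < 1 / 2 then frac x + 1 / 2 else frac x - 1 / 2)"
    by (simp add: frac_add)
  then show ?thesis using frac_ge_0[of x] frac_lt_1[of x] by (smt (verit) field_sum_of_halves)
qed

text \<open>Only upper bounds for the number of points in a half circle are at hand. Since the two
  complementary counts add up to M, an excess of at most E over M / 2 in both bounds their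
  difference by 2 E; this doubles the constants 3 and 4. Translation by 1 / 2 multiplies each
  exponential sum by a unimodular factor.\<close>

lemma chi_sum_le:
  fixes X :: "nat \<Rightarrow> real" and q :: nat
  assumes q: "4 \<le> q"
    and B: "\<And>h. 1 \<le> h \<Longrightarrow> h < 2 * q ^ 3 \<Longrightarrow> norm (\<Sum>n<M. cis (2 * pi * (real h * X n))) \<le> B"
    and B0: "0 \<le> B"
  shows "\<bar>\<Sum>n<M. real_of_int (chi (X n))\<bar> \<le> 6 * real M / real q + 8 * real q ^ 3 * B"
proof -
  define A where "A = {n. n < M \<and> frac (X n) < 1 / 2}"
  define A' where "A' = {n. n < M \<and> frac (X n + 1 / 2) < 1 / 2}"
  have fin: "finite A" "finite A'" unfolding A_def A'_def by simp_all
  have part: "{..<M} = A \<union> A'" "A \<inter> A' = {}"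
    unfolding A_def A'_def frac_add_half_less_half_iff by auto
  have "(\<Sum>n<M. real_of_int (chi (X n))) = (\<Sum>n\<in>A. real_of_int (chi (X n))) + (\<Sum>n\<in>A'. real_of_int (chi (X n)))"
    unfolding part(1) using fin part(2) by (intro sum.union_disjoint) auto
  also have "(\<Sum>n\<in>A. real_of_int (chi (X n))) = real (card A)"
    by (simp add: A_def chi_def)
  also have "(\<Sum>n\<in>A'. real_of_int (chi (X n))) = - real (card A')"
  proof -
    have "(\<Sum>n\<in>A'. real_of_int (chi (X n))) = (\<Sum>n\<in>A'. - 1)"
      unfolding A'_def frac_add_half_less_half_iff by (intro sum.cong) (auto simp: chi_def)
    then show ?thesis by simp
  qed
  finally have S: "(\<Sum>n<M. real_of_int (chi (X n))) = real (card A) - real (card A')" by simp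
  have "card {..<M} = card A + card A'"
    unfolding part(1) using fin part(2) by (intro card_Un_disjoint) auto
  then have MA: "real M = real (card A) + real (card A')" by simp
  have "norm (\<Sum>n<M. cis (2 * pi * (real h * (X n + 1 / 2)))) \<le> B" if "1 \<le> h" "h < 2 * q ^ 3" for h
  proof -
    have "(\<Sum>n<M. cis (2 * pi * (real h * (X n + 1 / 2)))) = cis (pi * real h) * (\<Sum>n<M. cis (2 * pi * (real h * X n)))"
      unfolding sum_distrib_left cis_mult by (simp add: algebra_simps)
    then show ?thesis using B[OF that] by (simp add: norm_mult)
  qed
  from card_frac_less_half_le[OF q this B0]
  have "real (card A') \<le> real M / 2 + 3 * real M / real q + 4 * real q ^ 3 * B" by (simp add: A'_def)
  moreover from card_frac_less_half_le[OF q B B0]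
  have "real (card A) \<le> real M / 2 + 3 * real M / real q + 4 * real q ^ 3 * B" by (simp add: A_def)
  moreover have "6 * real M / real q = 2 * (3 * real M / real q)" by simp
  ultimately show ?thesis unfolding S using MA by linarith
qed

text \<open>Passing to frequency h multiplies \<mu> and \<nu> by h. The smallness condition is
  stated for h = 2 q^3, where it is hardest to meet, while the saving is read off at h = 1, where it
  is weakest. A negative derivative is covered by complex conjugation.\<close>

lemma chi_sum_block_le:
  fixes F :: "nat \<Rightarrow> real" and q :: nat
  assumes "M \<le> L" "1 \<le> L" "0 < \<mu>" "4 * real q ^ 3 * \<nu> * real L ^ k \<le> 1" "\<mu> \<le> \<nu>" "4 \<le> q"
    and s: "s = 1 \<or> s = - 1"
    and d: "\<And>n. n + Suc k < M \<Longrightarrow> \<mu> \<le> s * fdiff (Suc k) F n \<and> s * fdiff (Suc k) F n \<le> \<nu>"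
    and mono: "(\<forall>n. n + Suc (Suc k) < M \<longrightarrow> fdiff (Suc k) F n \<le> fdiff (Suc k) F (n + 1)) \<or>
         (\<forall>n. n + Suc (Suc k) < M \<longrightarrow> fdiff (Suc k) F (n + 1) \<le> fdiff (Suc k) F n)"
  shows "\<bar>\<Sum>n<M. real_of_int (chi (F n))\<bar> \<le>
    6 * real L / real q + 40 * real q ^ 3 * real L * (\<mu> * real L ^ Suc k) powr (- 1 / 2 ^ Suc k)"
proof -
  define B where "B = 5 * real L * (\<mu> * real L ^ Suc k) powr (- 1 / 2 ^ Suc k)"
  have nu: "0 < \<nu>" using assms by linarith
  have "\<bar>\<Sum>n<M. real_of_int (chi (F n))\<bar> \<le> 6 * real M / real q + 8 * real q ^ 3 * B"
  proof (rule chi_sum_le[OF \<open>4 \<le> q\<close>])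
    fix h assume h: "1 \<le> h" "h < 2 * q ^ 3"
    have hr: "1 \<le> real h" "real h \<le> 2 * real q ^ 3"
    proof -
      have "real h \<le> real (2 * q ^ 3)" using h by (simp only: of_nat_le_iff)
      then show "real h \<le> 2 * real q ^ 3" by simp
    qed (use h in simp)
    define G where "G n = (s * real h) * F n" for n
    have G: "fdiff (Suc k) G n = real h * (s * fdiff (Suc k) F n)" for n
      unfolding G_def fdiff_mult by simp
    have "norm (\<Sum>n<M. cis (2 * pi * G n)) \<le>
       5 * real L * ((real h * \<mu>) * real L ^ Suc k) powr (- 1 / 2 ^ Suc k)"
    proof (rule exponential_sum_bound[of _ _ _ "real h * \<nu>"])
      show "M \<le> L" "1 \<le> L" "0 < real h * \<mu>" "real h * \<mu> \<le> real h * \<nu>" using assms hr by auto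
      have "real h * \<nu> * real L ^ k \<le> 2 * real q ^ 3 * \<nu> * real L ^ k"
        using hr nu by (intro mult_right_mono) auto
      also have "\<dots> \<le> 1 / 2" using assms(4) by simp
      finally show "real h * \<nu> * real L ^ k \<le> 1 / 2" .
      show "real h * \<mu> \<le> fdiff (Suc k) G n \<and> fdiff (Suc k) G n \<le> real h * \<nu>" if "n + Suc k < M" for n
        unfolding G using d[OF that] hr by (auto intro: mult_left_mono)
      have "real h * fdiff (Suc k) F n \<le> real h * fdiff (Suc k) F n'" if "fdiff (Suc k) F n \<le> fdiff (Suc k) F n'" for n n'
        using that hr by (intro mult_left_mono) auto
      then show "(\<forall>n. n + Suc (Suc k) < M \<longrightarrow> fdiff (Suc k) G n \<le> fdiff (Suc k) G (n + 1)) \<or>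
         (\<forall>n. n + Suc (Suc k) < M \<longrightarrow> fdiff (Suc k) G (n + 1) \<le> fdiff (Suc k) G n)"
        unfolding G using s mono by (elim disjE) (simp_all del: fdiff.simps)
    qed
    also have "\<dots> \<le> B"
      unfolding B_def
    proof (intro mult_left_mono powr_mono2')
      have "1 * (\<mu> * real L ^ Suc k) \<le> real h * (\<mu> * real L ^ Suc k)"
        using hr assms by (intro mult_right_mono) auto
      then show "\<mu> * real L ^ Suc k \<le> real h * \<mu> * real L ^ Suc k" by (simp add: mult.assoc)
    qed (use assms in auto)
    also have "norm (\<Sum>n<M. cis (2 * pi * G n)) = norm (\<Sum>n<M. cis (2 * pi * (real h * F n)))"
      using s
    proof
      assume "s = - 1"
      then have "(\<Sum>n<M. cis (2 * pi * G n)) = cnj (\<Sum>n<M. cis (2 * pi * (real h * F n)))"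
        by (simp add: G_def cis_cnj)
      then show ?thesis by (simp only: complex_mod_cnj)
    qed (simp add: G_def)
    finally show "norm (\<Sum>n<M. cis (2 * pi * (real h * F n))) \<le> B" .
  qed (simp add: B_def)
  also have "6 * real M / real q \<le> 6 * real L / real q" using assms by (intro divide_right_mono) auto
  finally show ?thesis by (simp add: B_def mult_ac)
qed

text \<open>Differencing with step a commutes with differentiation, so \<open>G\<close> is again a
  chain of derivatives; the induction hypothesis for \<open>G\<close> followed by one ordinary mean
  value step gives the claim.\<close>

lemma fdiff_mean_value:
  fixes g :: "nat \<Rightarrow> real \<Rightarrow> real"
  assumes "\<And>i x. i < k \<Longrightarrow> x0 \<le> x \<Longrightarrow> (g i has_real_derivative g (Suc i) x) (at x)"
    and "0 < a" "x0 \<le> y + a * real n"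
  shows "\<exists>\<xi>. y + a * real n \<le> \<xi> \<and> \<xi> \<le> y + a * real (n + k) \<and>
     fdiff k (\<lambda>n. g 0 (y + a * real n)) n = a ^ k * g k \<xi>"
  using assms(1)
proof (induction k arbitrary: g)
  case 0
  then show ?case by (intro exI[of _ "y + a * real n"]) simp
next
  case (Suc k)
  define G where "G i x = g i (x + a) - g i x" for i x
  have "\<exists>\<xi>. y + a * real n \<le> \<xi> \<and> \<xi> \<le> y + a * real (n + k) \<and>
     fdiff k (\<lambda>n. G 0 (y + a * real n)) n = a ^ k * G k \<xi>"
  proof (rule Suc.IH)
    fix i x assume ix: "i < k" "x0 \<le> x"
    have "((\<lambda>x. g i (x + a)) has_real_derivative g (Suc i) (x + a)) (at x)"
      using Suc.prems[of i "x + a"] ix \<open>0 < a\<close> by (simp add: DERIV_shift)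
    then show "(G i has_real_derivative G (Suc i) x) (at x)"
      unfolding G_def using Suc.prems[of i x] ix by (intro DERIV_diff) auto
  qed
  then obtain \<xi> where xi: "y + a * real n \<le> \<xi>" "\<xi> \<le> y + a * real (n + k)"
    "fdiff k (\<lambda>n. G 0 (y + a * real n)) n = a ^ k * G k \<xi>" by blast
  have "\<exists>z>\<xi>. z < \<xi> + a \<and> g k (\<xi> + a) - g k \<xi> = (\<xi> + a - \<xi>) * g (Suc k) z"
    using assms(2,3) xi(1) Suc.prems[of k] by (intro MVT2) auto
  then obtain z where z: "\<xi> < z" "z < \<xi> + a" "G k \<xi> = a * g (Suc k) z" by (auto simp: G_def)
  have "fdiff (Suc k) (\<lambda>n. g 0 (y + a * real n)) n = fdiff k (\<lambda>n. G 0 (y + a * real n)) n"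
    by (simp add: G_def algebra_simps)
  then have "fdiff (Suc k) (\<lambda>n. g 0 (y + a * real n)) n = a ^ Suc k * g (Suc k) z"
    using xi(3) z(3) by simp
  moreover have "z \<le> y + a * real (n + Suc k)" using z(2) xi(2) by (simp add: algebra_simps)
  ultimately show ?case using z(1) xi(1) by (intro exI[of _ z]) auto
qed

lemma sum_split_blocks_le:
  fixes u :: "nat \<Rightarrow> real"
  assumes "1 \<le> L" "0 \<le> B"
    and "\<And>s M'. M' \<le> L \<Longrightarrow> s + M' \<le> M \<Longrightarrow> \<bar>\<Sum>n<M'. u (s + n)\<bar> \<le> B"
  shows "\<bar>\<Sum>n<M. u n\<bar> \<le> (real M / real L + 1) * B"
  using assms(3)
proof (induction M arbitrary: u rule: less_induct)
  case (less M)
  show ?case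
  proof (cases "M \<le> L")
    case True
    then have "\<bar>\<Sum>n<M. u n\<bar> \<le> 1 * B" using less.prems[of M 0] by simp
    also have "\<dots> \<le> (real M / real L + 1) * B" using assms by (intro mult_right_mono) auto
    finally show ?thesis .
  next
    case False
    define M' where "M' = M - L"
    have M: "M = L + M'" "M' < M" using False assms(1) by (auto simp: M'_def)
    have "(\<Sum>n<M. u n) = (\<Sum>n<L. u n) + (\<Sum>n<M'. u (L + n))"
      unfolding M(1) by (induction M') (simp_all add: add.assoc)
    moreover have "\<bar>\<Sum>n<L. u n\<bar> \<le> B" using less.prems[of L 0] M by simp
    moreover have "\<bar>\<Sum>n<M'. u (L + n)\<bar> \<le> (real M' / real L + 1) * B"
    proof (rule less.IH[OF M(2)])
      fix s m assume "m \<le> L" "s + m \<le> M'"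
      then show "\<bar>\<Sum>n<m. u (L + (s + n))\<bar> \<le> B"
        using less.prems[of m "L + s"] M by (simp add: add.assoc)
    qed
    ultimately have "\<bar>\<Sum>n<M. u n\<bar> \<le> B + (real M' / real L + 1) * B" by linarith
    also have "\<dots> = (real M / real L + 1) * B" using assms(1) by (simp add: M(1) field_simps)
    finally show ?thesis .
  qed
qed

text \<open>The mean value theorem turns derivative bounds into difference bounds with a factor
  \<open>a ^ Suc k\<close>. It is kept in the upper bound and discarded in the lower one, as a \<ge>
  1. The sign of the next derivative makes these differences monotone.\<close>

lemma chi_progression_sum_le:
  fixes g :: "nat \<Rightarrow> real \<Rightarrow> real" and q L :: nat
  assumes der: "\<And>i x. i \<le> Suc k \<Longrightarrow> Y \<le> x \<Longrightarrow> (g i has_real_derivative g (Suc i) x) (at x)"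
    and s: "s = 1 \<or> s = - 1"
    and bd: "\<And>x. Y \<le> x \<Longrightarrow> x \<le> Z \<Longrightarrow> \<mu> \<le> s * g (Suc k) x \<and> s * g (Suc k) x \<le> \<nu>"
    and sg: "(\<forall>x\<ge>Y. 0 \<le> g (Suc (Suc k)) x) \<or> (\<forall>x\<ge>Y. g (Suc (Suc k)) x \<le> 0)"
    and a: "1 \<le> a" and y: "Y \<le> y" "y + a * real M \<le> Z + a" and munu: "0 < \<mu>" "\<mu> \<le> \<nu>"
    and L: "1 \<le> L" and q: "4 \<le> q"
    and small: "4 * real q ^ 3 * (a ^ Suc k * \<nu>) * real L ^ k \<le> 1"
  shows "\<bar>\<Sum>n<M. real_of_int (chi (g 0 (y + a * real n)))\<bar> \<le> (real M / real L + 1) *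
    (6 * real L / real q + 40 * real q ^ 3 * real L * (\<mu> * real L ^ Suc k) powr (- 1 / 2 ^ Suc k))"
proof (rule sum_split_blocks_le[OF L])
  fix t M' assume M': "M' \<le> L" "t + M' \<le> M"
  define F where "F n = g 0 ((y + a * real t) + a * real n)" for n
  have yt: "Y \<le> (y + a * real t) + a * real n" for n
    using y(1) a by (intro order.trans[OF _ add_increasing2[OF _ add_increasing2]]) auto
  have "\<bar>\<Sum>n<M'. real_of_int (chi (F n))\<bar> \<le>
    6 * real L / real q + 40 * real q ^ 3 * real L * (\<mu> * real L ^ Suc k) powr (- 1 / 2 ^ Suc k)"
  proof (rule chi_sum_block_le[OF M'(1) L munu(1) small _ q s])
    have ak: "1 \<le> a ^ Suc k" using a by (rule one_le_power)
    have "1 * \<nu> \<le> a ^ Suc k * \<nu>" using ak munu by (intro mult_right_mono) auto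
    then show "\<mu> \<le> a ^ Suc k * \<nu>" using munu by linarith
    show "\<mu> \<le> s * fdiff (Suc k) F n \<and> s * fdiff (Suc k) F n \<le> a ^ Suc k * \<nu>" if n: "n + Suc k < M'" for n
    proof -
      have "\<exists>\<xi>. (y + a * real t) + a * real n \<le> \<xi> \<and> \<xi> \<le> (y + a * real t) + a * real (n + Suc k) \<and>
        fdiff (Suc k) F n = a ^ Suc k * g (Suc k) \<xi>"
        unfolding F_def by (rule fdiff_mean_value[where g = g, OF _ _ yt]) (use der a in auto)
      then obtain \<xi> where xi: "(y + a * real t) + a * real n \<le> \<xi>"
        "\<xi> \<le> (y + a * real t) + a * real (n + Suc k)"
        "fdiff (Suc k) F n = a ^ Suc k * g (Suc k) \<xi>" by blast
      \<comment> \<open>The extra 1 is paid for by the \<open>+ a\<close> in the hypothesis on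
        \<open>Z\<close>: the last term of the progression is y + a (M - 1), and that point has to
        be at most Z.\<close>
      have "a * real (t + (n + Suc k) + 1) \<le> a * real M"
        using n M'(2) a by (intro mult_left_mono) auto
      then have "\<xi> \<le> Z" using xi(2) y(2) by (simp add: algebra_simps)
      moreover have "Y \<le> \<xi>" using yt[of n] xi(1) by linarith
      ultimately have b: "\<mu> \<le> s * g (Suc k) \<xi>" "s * g (Suc k) \<xi> \<le> \<nu>" using bd by auto
      have "1 * \<mu> \<le> a ^ Suc k * (s * g (Suc k) \<xi>)"
        using ak b munu by (intro mult_mono) auto
      moreover have "a ^ Suc k * (s * g (Suc k) \<xi>) \<le> a ^ Suc k * \<nu>"
        using ak b by (intro mult_left_mono) auto
      ultimately show ?thesis unfolding xi(3) by (simp add: mult_ac)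
    qed
    have ex: "\<exists>\<xi>\<ge>Y. fdiff (Suc k) F (n + 1) - fdiff (Suc k) F n = a ^ Suc (Suc k) * g (Suc (Suc k)) \<xi>" for n
    proof -
      have "\<exists>\<xi>. (y + a * real t) + a * real n \<le> \<xi> \<and> \<xi> \<le> (y + a * real t) + a * real (n + Suc (Suc k)) \<and>
        fdiff (Suc (Suc k)) F n = a ^ Suc (Suc k) * g (Suc (Suc k)) \<xi>"
        unfolding F_def by (rule fdiff_mean_value[where g = g, OF _ _ yt]) (use der a in auto)
      then obtain \<xi> where xi: "(y + a * real t) + a * real n \<le> \<xi>"
        "fdiff (Suc (Suc k)) F n = a ^ Suc (Suc k) * g (Suc (Suc k)) \<xi>" by blast
      then have "Y \<le> \<xi>" using yt[of n] by linarith
      then show ?thesis using xi(2) unfolding fdiff_Suc_diff[of "Suc k" F n] by blast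
    qed
    show "(\<forall>n. n + Suc (Suc k) < M' \<longrightarrow> fdiff (Suc k) F n \<le> fdiff (Suc k) F (n + 1)) \<or>
         (\<forall>n. n + Suc (Suc k) < M' \<longrightarrow> fdiff (Suc k) F (n + 1) \<le> fdiff (Suc k) F n)"
      using sg
    proof
      assume *: "\<forall>x\<ge>Y. 0 \<le> g (Suc (Suc k)) x"
      have "fdiff (Suc k) F n \<le> fdiff (Suc k) F (n + 1)" for n
      proof -
        obtain \<xi> where "\<xi> \<ge> Y" "fdiff (Suc k) F (n + 1) - fdiff (Suc k) F n = a ^ Suc (Suc k) * g (Suc (Suc k)) \<xi>"
          using ex[of n] by blast
        moreover from this(1) have "0 \<le> a ^ Suc (Suc k) * g (Suc (Suc k)) \<xi>"
          using * a by (intro mult_nonneg_nonneg) auto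
        ultimately show ?thesis by linarith
      qed
      then show ?thesis by blast
    next
      assume *: "\<forall>x\<ge>Y. g (Suc (Suc k)) x \<le> 0"
      have "fdiff (Suc k) F (n + 1) \<le> fdiff (Suc k) F n" for n
      proof -
        obtain \<xi> where "\<xi> \<ge> Y" "fdiff (Suc k) F (n + 1) - fdiff (Suc k) F n = a ^ Suc (Suc k) * g (Suc (Suc k)) \<xi>"
          using ex[of n] by blast
        moreover from this(1) have "a ^ Suc (Suc k) * g (Suc (Suc k)) \<xi> \<le> 0"
          using * a by (intro mult_nonneg_nonpos) auto
        ultimately show ?thesis by linarith
      qed
      then show ?thesis by blast
    qed
  qed
  then show "\<bar>\<Sum>n<M'. real_of_int (chi (g 0 (y + a * real (t + n))))\<bar> \<le>
    6 * real L / real q + 40 * real q ^ 3 * real L * (\<mu> * real L ^ Suc k) powr (- 1 / 2 ^ Suc k)"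
    by (simp add: F_def algebra_simps)
qed simp

text \<open>Blocks have length about \<open>X\<^sup>\<tau>\<close>. The exponent \<open>\<tau>\<close> lies slightly above \<open>- c / k\<close>, so that
  \<open>X\<^sup>c L\<^sup>k\<close> is a positive power of \<open>X\<close>, and below \<open>- c / (k - 1)\<close>, so that \<open>X\<^sup>c L\<^sup>k\<^sup>-\<^sup>1\<close> is a
  negative one, with room for the factors \<open>X\<^sup>\<eta>\<close>, \<open>X\<^sup>\<sigma>\<close> and \<open>X\<^sup>\<rho>\<close>.\<close>

lemma block_parameters:
  fixes X a c \<rho> :: real and k m q L :: nat
  defines "\<kappa> \<equiv> 1 / (4 * real k * real m)"
  defines "\<eta> \<equiv> \<kappa> * (1 / 2 ^ k) / 4"
  defines "\<sigma> \<equiv> \<eta> / real k"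
  defines "\<tau> \<equiv> (- c + \<kappa>) / real k"
  assumes k: "2 \<le> k" and m: "2 \<le> m" and c: "- real k + 1 / real m \<le> c" "c < - 1 / 2"
    and rho: "0 \<le> \<rho>" "\<rho> \<le> \<eta>"
    and X: "1 \<le> X" "32 * 2 ^ (k - 1) * X powr (- 1 / (4 * real k)) \<le> 1"
    and q: "X powr \<eta> \<le> real q" "real q \<le> 2 * X powr \<eta>"
    and L: "X powr \<tau> \<le> real L" "real L \<le> 2 * X powr \<tau>"
    and a: "1 \<le> a" "a \<le> X powr \<sigma>"
  shows "4 * real q ^ 3 * (a ^ k * X powr ((1 - \<sigma>) * (c + \<rho>))) * real L ^ (k - 1) \<le> 1"
    and "(X powr c * real L ^ k) powr (- 1 / 2 ^ k) \<le> X powr (- 4 * \<eta>)"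
    and "\<tau> \<le> 1" "c + \<rho> \<le> 0" "\<sigma> \<le> \<eta>"
proof -
  have k0: "real k \<ge> 2" and m0: "real m \<ge> 2" using k m by auto
  have kap: "0 < \<kappa>" "\<kappa> \<le> 1 / (8 * real k)" "\<kappa> \<le> 1 / real m" "\<kappa> \<le> 1 / 16"
  proof -
    show "0 < \<kappa>" using k0 m0 by (simp add: \<kappa>_def)
    have "8 * real k \<le> 4 * real k * real m" using k0 m0 by simp
    then show "\<kappa> \<le> 1 / (8 * real k)" unfolding \<kappa>_def using k0 by (intro divide_left_mono) auto
    also have "\<dots> \<le> 1 / 16" using k0 by (intro divide_left_mono) auto
    finally show "\<kappa> \<le> 1 / 16" .
    have "1 * real m \<le> 4 * real k * real m" using k0 m0 by (intro mult_right_mono) auto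
    then show "\<kappa> \<le> 1 / real m" unfolding \<kappa>_def using m0 by (intro divide_left_mono) auto
  qed
  have "(2::real) ^ 2 \<le> 2 ^ k" using k by (intro power_increasing) auto
  then have S: "(1::real) / 2 ^ k \<le> 1 / 4" by (simp add: field_simps)
  have eta: "0 < \<eta>" "\<eta> \<le> \<kappa> / 16"
  proof -
    show "0 < \<eta>" using kap by (simp add: \<eta>_def)
    have "\<eta> \<le> \<kappa> * (1 / 4) / 4"
      unfolding \<eta>_def using S kap(1) by (intro divide_right_mono mult_left_mono) auto
    then show "\<eta> \<le> \<kappa> / 16" by simp
  qed
  have sig0: "0 < \<sigma>" using eta k0 by (simp add: \<sigma>_def)
  show "\<sigma> \<le> \<eta>" using eta k0 by (simp add: \<sigma>_def field_simps)
  have crho: "c + \<rho> < 0" using c(2) rho(2) eta(2) kap(4) by linarith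
  then show "c + \<rho> \<le> 0" by simp
  have tauk: "real k * \<tau> = - c + \<kappa>" using k0 by (simp add: \<tau>_def)
  have "- c + \<kappa> \<le> real k" using c(1) kap(3) by linarith
  then show "\<tau> \<le> 1" using k0 by (simp add: \<tau>_def)
  have X0: "0 < X" using X by linarith
  have pk: "(X powr t) ^ n = X powr (real n * t)" for t n
    using X0 by (simp add: powr_powr mult.commute flip: powr_realpow)
  \<comment> \<open>By the choice of \<tau>, X^c L^k is at least X^\<kappa>, and \<eta> is chosen
    such that the root of order 2^k gives X^(-4 \<eta>). Three of these four \<eta> will pay for
    q^3; the remaining one matches the term 1 / q.\<close>
  show "(X powr c * real L ^ k) powr (- 1 / 2 ^ k) \<le> X powr (- 4 * \<eta>)"
  proof -
    have "X powr \<kappa> = X powr c * X powr (real k * \<tau>)" by (simp add: tauk flip: powr_add)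
    also have "\<dots> = X powr c * (X powr \<tau>) ^ k" by (simp only: pk)
    also have "\<dots> \<le> X powr c * real L ^ k" using L by (intro mult_left_mono power_mono) auto
    finally have "(X powr c * real L ^ k) powr (- 1 / 2 ^ k) \<le> (X powr \<kappa>) powr (- 1 / 2 ^ k)"
      using X0 by (intro powr_mono2') auto
    also have "\<dots> = X powr (- 4 * \<eta>)" by (simp add: powr_powr \<eta>_def)
    finally show ?thesis .
  qed
  \<comment> \<open>The exponents add up to at most 6 \<eta> + \<kappa> - \<tau>. In units of 1 / (8
    k), \<tau> is at least 4, while \<kappa> and 6 \<eta> are at most 1 each. The factor a^k costs
    only one \<eta> since k \<sigma> = \<eta>.\<close>
  have expo: "3 * \<eta> + (real k * \<sigma> + (1 - \<sigma>) * (c + \<rho>)) + real (k - 1) * \<tau> \<le> - 1 / (4 * real k)"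
  proof -
    have ks: "real k * \<sigma> = \<eta>" using k0 by (simp add: \<sigma>_def)
    have "- (c + \<rho>) \<le> real k" using c(1) rho(1) m0 by (smt (verit) divide_nonneg_nonneg)
    then have "\<sigma> * (- (c + \<rho>)) \<le> \<sigma> * real k" using sig0 by (intro mult_left_mono) auto
    then have s1: "(1 - \<sigma>) * (c + \<rho>) \<le> c + \<eta> + \<eta>" using ks rho by (simp add: algebra_simps)
    have "real (k - 1) * \<tau> = real k * \<tau> - \<tau>" using k by (simp add: of_nat_diff algebra_simps)
    also have "\<dots> = - c + \<kappa> - \<tau>" by (simp add: tauk)
    finally have s2: "real (k - 1) * \<tau> = - c + \<kappa> - \<tau>" .
    have "(1 / 2) / real k \<le> \<tau>" unfolding \<tau>_def using c(2) kap k0 by (intro divide_right_mono) auto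
    then have "4 * (1 / (8 * real k)) \<le> \<tau>" by simp
    moreover have "1 / (4 * real k) = 2 * (1 / (8 * real k))" by simp
    moreover have "- 1 / (4 * real k) = - (1 / (4 * real k))" by simp
    ultimately show ?thesis using s1 s2 ks eta kap(1,2) by linarith
  qed
  have "4 * real q ^ 3 * (a ^ k * X powr ((1 - \<sigma>) * (c + \<rho>))) * real L ^ (k - 1)
     \<le> 4 * (2 * X powr \<eta>) ^ 3 * ((X powr \<sigma>) ^ k * X powr ((1 - \<sigma>) * (c + \<rho>))) * (2 * X powr \<tau>) ^ (k - 1)"
    using q L a by (intro mult_mono power_mono) auto
  also have "\<dots> = 32 * 2 ^ (k - 1) * X powr (3 * \<eta> + (real k * \<sigma> + (1 - \<sigma>) * (c + \<rho>)) + real (k - 1) * \<tau>)"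
    by (simp only: power_mult_distrib pk powr_add) simp
  also have "\<dots> \<le> 32 * 2 ^ (k - 1) * X powr (- 1 / (4 * real k))"
    using expo X by (intro mult_left_mono powr_mono) auto
  also have "\<dots> \<le> 1" by (rule X(2))
  finally show "4 * real q ^ 3 * (a ^ k * X powr ((1 - \<sigma>) * (c + \<rho>))) * real L ^ (k - 1) \<le> 1" .
qed

lemma nat_ceiling_bounds:
  fixes x :: real
  assumes "1 \<le> x"
  shows "x \<le> real (nat \<lceil>x\<rceil>)" "real (nat \<lceil>x\<rceil>) \<le> 2 * x"
  using assms by linarith+

lemma abs_chi_sum_le: "\<bar>\<Sum>n\<in>A. real_of_int (chi (u n))\<bar> \<le> real (card A)"
proof -
  have "\<bar>\<Sum>n\<in>A. real_of_int (chi (u n))\<bar> \<le> (\<Sum>n\<in>A. \<bar>real_of_int (chi (u n))\<bar>)" by (rule sum_abs)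
  also have "\<dots> = (\<Sum>n\<in>A. 1)" by (intro sum.cong) (auto simp: chi_def)
  finally show ?thesis by simp
qed

lemma weakly_signed_eventually_abs:
  assumes "weakly_signed w"
  obtains s :: real where "s = 1 \<or> s = - 1" "\<forall>\<^sub>F x in at_top. s * w x = \<bar>w x\<bar>"
  using assms unfolding weakly_signed_def
proof
  assume "\<forall>\<^sub>F x in at_top. 0 \<le> w x"
  then have "\<forall>\<^sub>F x in at_top. 1 * w x = \<bar>w x\<bar>" by eventually_elim simp
  then show thesis using that by blast
next
  assume "\<forall>\<^sub>F x in at_top. w x \<le> 0"
  then have "\<forall>\<^sub>F x in at_top. (- 1) * w x = \<bar>w x\<bar>" by eventually_elim simp
  then show thesis using that by blast
qed

text \<open>The order of the choices avoids circularity: m fixes \<kappa>, \<eta> and \<sigma>, then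
  r is taken with 1 / r \<le> \<eta>, and only then is c obtained from the grid of mesh 1 / r. Among
  the exponents of the final estimate only the block exponent \<tau> depends on c.\<close>

lemma (in hardy) chi_progression_power_saving:
  assumes "mem f" "of_type_power_plus l f"
  obtains \<sigma> :: real and N0 :: nat where "0 < \<sigma>" "\<sigma> \<le> 1"
    "\<And>N a y0 M :: nat. N0 \<le> N \<Longrightarrow> 1 \<le> a \<Longrightarrow> 1 \<le> M \<Longrightarrow> y0 \<ge> 1 \<Longrightarrow> y0 + a * (M - 1) \<le> N \<Longrightarrow>
       \<bar>\<Sum>n<M. real_of_int (chi (f (real y0 + real a * real n)))\<bar> \<le> 980 * real N powr (1 - \<sigma>)"
proof -
  obtain g where g0: "g 0 = f" and g: "\<And>i. mem (g i)"
    "\<And>i. \<forall>\<^sub>F x in at_top. (g i has_real_derivative g (Suc i) x) (at x)"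
    using mem_iterated_deriv[OF assms(1)] by blast
  have t: "of_type_power_plus l (g 0)" using assms(2) g0 by simp
  obtain m :: nat where m: "m \<ge> 2" "\<forall>\<^sub>F x in at_top. x powr (- real (l + 2) + 1 / real m) \<le> \<bar>g (l + 2) x\<bar>"
    by (rule deriv_lower_bound[of g l, OF g t])
  define k where "k = l + 2"
  define \<kappa> where "\<kappa> = 1 / (4 * real k * real m)"
  define \<eta> where "\<eta> = \<kappa> * (1 / 2 ^ k) / 4"
  define \<sigma> where "\<sigma> = \<eta> / real k"
  have eta0: "0 < \<eta>" using m(1) by (simp add: \<eta>_def \<kappa>_def k_def)
  define r where "r = nat \<lceil>1 / \<eta>\<rceil>"
  have "1 / \<eta> \<le> real r" unfolding r_def by linarith
  then have r: "r > 0" "1 / real r \<le> \<eta>"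
  proof -
    assume *: "1 / \<eta> \<le> real r"
    moreover have "0 < 1 / \<eta>" using eta0 by simp
    ultimately have "0 < real r" by linarith
    then show "r > 0" by simp
    then show "1 / real r \<le> \<eta>" using * eta0 by (simp add: field_simps)
  qed
  obtain c where c: "- real (l + 2) + 1 / real m \<le> c" "c < - 1 / 2"
    "\<forall>\<^sub>F x in at_top. x powr c \<le> \<bar>g (l + 2) x\<bar>" "\<forall>\<^sub>F x in at_top. \<bar>g (l + 2) x\<bar> \<le> x powr (c + 1 / real r)"
    by (rule deriv_exponent[of g l, OF g t m r(1)])
  define \<rho> where "\<rho> = 1 / real r"
  have rho: "0 \<le> \<rho>" "\<rho> \<le> \<eta>" using r by (simp_all add: \<rho>_def)
  define \<tau> where "\<tau> = (- c + \<kappa>) / real k"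
  note params = block_parameters[of k m c \<rho>, folded \<kappa>_def, folded \<eta>_def, folded \<sigma>_def, folded \<tau>_def]
  have k2: "2 \<le> k" by (simp add: k_def)
  have ck: "- real k + 1 / real m \<le> c" using c(1) by (simp add: k_def)
  obtain s where s: "s = 1 \<or> s = - 1" "\<forall>\<^sub>F x in at_top. s * g k x = \<bar>g k x\<bar>"
    using weakly_signed_eventually_abs[OF mem_weakly_signed[OF g(1)[of k]]] by blast
  obtain s' where s': "s' = 1 \<or> s' = - 1" "\<forall>\<^sub>F x in at_top. s' * g (Suc k) x = \<bar>g (Suc k) x\<bar>"
    using weakly_signed_eventually_abs[OF mem_weakly_signed[OF g(1)[of "Suc k"]]] by blast
  have "\<forall>\<^sub>F x in at_top. \<forall>i\<in>{..k}. (g i has_real_derivative g (Suc i) x) (at x)"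
    using g(2) by (intro eventually_ball_finite) auto
  with s(2) s'(2) c(3,4)
  have "\<forall>\<^sub>F x in at_top. (\<forall>i\<le>k. (g i has_real_derivative g (Suc i) x) (at x)) \<and>
     s * g k x = \<bar>g k x\<bar> \<and> s' * g (Suc k) x = \<bar>g (Suc k) x\<bar> \<and>
     x powr c \<le> \<bar>g k x\<bar> \<and> \<bar>g k x\<bar> \<le> x powr (c + \<rho>)"
    unfolding k_def[symmetric] \<rho>_def[symmetric] by eventually_elim auto
  then obtain x0 where x0: "\<And>x. x \<ge> x0 \<Longrightarrow> (\<forall>i\<le>k. (g i has_real_derivative g (Suc i) x) (at x)) \<and>
     s * g k x = \<bar>g k x\<bar> \<and> s' * g (Suc k) x = \<bar>g (Suc k) x\<bar> \<and>
     x powr c \<le> \<bar>g k x\<bar> \<and> \<bar>g k x\<bar> \<le> x powr (c + \<rho>)"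
    unfolding eventually_at_top_linorder by blast
  have kap: "\<kappa> \<le> 1"
  proof -
    have "1 * 1 \<le> real k * real m" using k2 m(1) by (intro mult_mono) auto
    then show ?thesis by (simp add: \<kappa>_def)
  qed
  have eta1: "\<eta> \<le> 1"
  proof -
    have "\<eta> \<le> 1 * 1 / 4"
      unfolding \<eta>_def using kap by (intro divide_right_mono mult_mono) (auto simp: field_simps)
    then show ?thesis by simp
  qed
  have sig: "0 < \<sigma>" "\<sigma> < 1"
  proof -
    show "0 < \<sigma>" using eta0 k2 by (simp add: \<sigma>_def)
    have "\<eta> < real k" using eta1 k2 by linarith
    then show "\<sigma> < 1" using k2 by (simp add: \<sigma>_def)
  qed
  have "filterlim (\<lambda>X::real. X powr (1 - \<sigma>)) at_top at_top" using sig by real_asymp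
  then have ev1: "\<forall>\<^sub>F X in at_top. x0 \<le> X powr (1 - \<sigma>)" by (simp add: filterlim_at_top)
  have "filterlim (\<lambda>X::real. X powr \<eta>) at_top at_top" using eta0 by real_asymp
  then have ev2: "\<forall>\<^sub>F X in at_top. 4 \<le> X powr \<eta>" by (simp add: filterlim_at_top)
  define w where "w = 1 / (4 * real k)"
  have w: "w > 0" using k2 by (simp add: w_def)
  have "((\<lambda>X::real. (32 * 2 ^ (k - 1)) * X powr (- w)) \<longlongrightarrow> 0) at_top" using w by real_asymp
  then have ev3: "\<forall>\<^sub>F X in at_top. 32 * 2 ^ (k - 1) * X powr (- w) < 1"
    by (rule order_tendstoD) simp
  have "\<forall>\<^sub>F X::real in at_top. 1 \<le> X \<and> x0 \<le> X powr (1 - \<sigma>) \<and> 4 \<le> X powr \<eta> \<and>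
     32 * 2 ^ (k - 1) * X powr (- w) < 1"
    using ev1 ev2 ev3 eventually_ge_at_top[of 1] by eventually_elim auto
  then obtain X0 where X0: "\<And>X::real. X \<ge> X0 \<Longrightarrow> 1 \<le> X \<and> x0 \<le> X powr (1 - \<sigma>) \<and> 4 \<le> X powr \<eta> \<and>
     32 * 2 ^ (k - 1) * X powr (- w) < 1"
    unfolding eventually_at_top_linorder by blast
  show ?thesis
  proof (rule that[OF sig(1) less_imp_le[OF sig(2)], of "nat \<lceil>X0\<rceil>"])
    fix N a y0 M :: nat
    assume N: "nat \<lceil>X0\<rceil> \<le> N" and a: "1 \<le> a" and M: "1 \<le> M" and y0: "1 \<le> y0" and le: "y0 + a * (M - 1) \<le> N"
    define X where "X = real N"
    have "X0 \<le> X" using N unfolding X_def by linarith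
    from X0[OF this] have X: "1 \<le> X" "x0 \<le> X powr (1 - \<sigma>)" "4 \<le> X powr \<eta>"
      "32 * 2 ^ (k - 1) * X powr (- w) \<le> 1" by auto
    have leX: "real y0 + real a * (real M - 1) \<le> X"
    proof -
      have "real (y0 + a * (M - 1)) \<le> X" using le unfolding X_def of_nat_le_iff .
      then show ?thesis using M by (simp add: of_nat_diff)
    qed
    have X1s: "1 \<le> X powr (1 - \<sigma>)" using X(1) sig by (intro ge_one_powr_ge_zero) auto
    let ?u = "\<lambda>n. real_of_int (chi (f (real y0 + real a * real n)))"
    have trivial: "\<bar>\<Sum>n<M. ?u n\<bar> \<le> real M" using abs_chi_sum_le[of _ "{..<M}"] by simp
    define n0 where "n0 = nat \<lceil>X powr (1 - \<sigma>)\<rceil>"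
    have n0: "X powr (1 - \<sigma>) \<le> real n0" "real n0 \<le> 2 * X powr (1 - \<sigma>)"
      unfolding n0_def using nat_ceiling_bounds[OF X1s] by auto
    \<comment> \<open>Here 980 = 2 + 3 (6 + 40 * 8): the initial terms number at most 2
      X^(1-\<sigma>), q \<le> 2 X^\<eta> turns 40 q^3 into 320 X^(3 \<eta>), and M' + L \<le> 3
      X.\<close>
    have "\<bar>\<Sum>n<M. ?u n\<bar> \<le> 980 * X powr (1 - \<sigma>)"
    proof (cases "real a \<le> X powr \<sigma> \<and> n0 < M")
      case False
      then consider "M \<le> n0" | "X powr \<sigma> < real a" by linarith
      then have "real M \<le> 2 * X powr (1 - \<sigma>)"
      proof cases
        case 1
        then have "real M \<le> real n0" by simp
        then show ?thesis using n0 by linarith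
      next
        case 2
        have "X powr \<sigma> * (real M - 1) \<le> real a * (real M - 1)"
          using 2 M by (intro mult_right_mono) auto
        also have "\<dots> \<le> X" using leX by linarith
        also have "X = X powr \<sigma> * X powr (1 - \<sigma>)" using X(1) by (simp flip: powr_add)
        finally have "real M - 1 \<le> X powr (1 - \<sigma>)" using X(1) by (simp add: mult_le_cancel_left_pos)
        then show ?thesis using X1s by linarith
      qed
      then show ?thesis using trivial X1s by linarith
    next
      case True
      define M' where "M' = M - n0"
      have MM: "M = n0 + M'" using True by (simp add: M'_def)
      define q where "q = nat \<lceil>X powr \<eta>\<rceil>"
      define L where "L = nat \<lceil>X powr \<tau>\<rceil>"
      have q: "X powr \<eta> \<le> real q" "real q \<le> 2 * X powr \<eta>"
        unfolding q_def using nat_ceiling_bounds[of "X powr \<eta>"] X(3) by auto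
      have q4: "4 \<le> q" using q(1) X(3) by linarith
      have tau0: "0 < \<tau>" using c(2) eta0 k2 m(1) unfolding \<tau>_def \<kappa>_def
        by (intro divide_pos_pos add_pos_pos) auto
      have L: "X powr \<tau> \<le> real L" "real L \<le> 2 * X powr \<tau>"
        unfolding L_def using nat_ceiling_bounds[of "X powr \<tau>"] X(1) tau0 by (auto simp: ge_one_powr_ge_zero)
      have L1: "1 \<le> L"
        using L(1) ge_one_powr_ge_zero[of X \<tau>] X(1) tau0 by linarith
      have a1: "1 \<le> real a" using a by simp
      have X4: "32 * 2 ^ (k - 1) * X powr (- 1 / (4 * real k)) \<le> 1" using X(4) by (simp add: w_def)
      note p = params[OF k2 m(1) ck c(2) rho X(1) X4 q L a1 conjunct1[OF True]]
      define Y where "Y = X powr (1 - \<sigma>)"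
      define \<mu> where "\<mu> = X powr c"
      define \<nu> where "\<nu> = X powr ((1 - \<sigma>) * (c + \<rho>))"
      have YX: "Y \<le> X" unfolding Y_def using X(1) sig powr_mono[of "1 - \<sigma>" 1 X] by simp
      \<comment> \<open>Both exponents are nonpositive, so the lower bound is taken at the right end
        X and the upper bound at the left end Y.\<close>
      have bd: "\<mu> \<le> s * g k x \<and> s * g k x \<le> \<nu>" if x: "Y \<le> x" "x \<le> X" for x
      proof -
        have xx: "x0 \<le> x" "1 \<le> x" using x X X1s by (simp_all add: Y_def)
        have sx: "s * g k x = \<bar>g k x\<bar>" "x powr c \<le> \<bar>g k x\<bar>" "\<bar>g k x\<bar> \<le> x powr (c + \<rho>)"
          using x0[OF xx(1)] by auto
        have "\<mu> \<le> x powr c" unfolding \<mu>_def using xx x c(2) by (intro powr_mono2') auto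
        moreover have "x powr (c + \<rho>) \<le> Y powr (c + \<rho>)"
          using x X1s p(4) by (intro powr_mono2') (auto simp: Y_def)
        moreover have "Y powr (c + \<rho>) = \<nu>" by (simp add: Y_def \<nu>_def powr_powr)
        ultimately show ?thesis using sx by linarith
      qed
      have munu: "0 < \<mu>" "\<mu> \<le> \<nu>" using bd[OF YX order.refl] X(1) by (auto simp: \<mu>_def)
      have kk: "Suc (l + 1) = k" by (simp add: k_def)
      \<comment> \<open>Since a \<ge> 1, discarding n0 \<ge> Y terms moves the progression beyond Y
        for every starting point y0.\<close>
      have ge: "Y \<le> real y0 + real a * real n0"
      proof -
        have "1 * real n0 \<le> real a * real n0" using a1 by (intro mult_right_mono) auto
        then show ?thesis using n0(1) by (simp add: Y_def)
      qed
      have "\<bar>\<Sum>n<M'. real_of_int (chi (g 0 ((real y0 + real a * real n0) + real a * real n)))\<bar> \<le>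
        (real M' / real L + 1) * (6 * real L / real q +
          40 * real q ^ 3 * real L * (\<mu> * real L ^ Suc (l + 1)) powr (- 1 / 2 ^ Suc (l + 1)))"
      proof (rule chi_progression_sum_le[where Y = Y and Z = X and s = s and \<nu> = \<nu>])
        show "(g i has_real_derivative g (Suc i) x) (at x)" if "i \<le> Suc (l + 1)" "Y \<le> x" for i x
          using x0[of x] X(2) that by (simp add: Y_def k_def)
        show "s = 1 \<or> s = - 1" by (rule s(1))
        show "\<mu> \<le> s * g (Suc (l + 1)) x \<and> s * g (Suc (l + 1)) x \<le> \<nu>" if "Y \<le> x" "x \<le> X" for x
          unfolding kk by (rule bd[OF that])
        have "s' * g (Suc k) x = \<bar>g (Suc k) x\<bar>" if "x \<ge> Y" for x
          using x0[of x] X(2) that by (simp add: Y_def)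
        then show "(\<forall>x\<ge>Y. 0 \<le> g (Suc (Suc (l + 1))) x) \<or> (\<forall>x\<ge>Y. g (Suc (Suc (l + 1))) x \<le> 0)"
          unfolding kk using s'(1) by (metis abs_ge_zero mult_1 mult_minus1 neg_0_le_iff_le)
        show "1 \<le> real a" by (rule a1)
        show "Y \<le> real y0 + real a * real n0" by (rule ge)
        show "real y0 + real a * real n0 + real a * real M' \<le> X + real a"
          using leX by (simp add: MM algebra_simps)
        show "0 < \<mu>" "\<mu> \<le> \<nu>" "1 \<le> L" "4 \<le> q" using munu L1 q4 by auto
        show "4 * real q ^ 3 * (real a ^ Suc (l + 1) * \<nu>) * real L ^ (l + 1) \<le> 1"
          using p(1) unfolding kk \<nu>_def by (simp add: k_def)
      qed
      also have "\<dots> \<le> (real M' / real L + 1) * (326 * real L * X powr (- \<eta>))"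
      proof (intro mult_left_mono)
        have "6 * real L / real q \<le> 6 * real L / X powr \<eta>"
          using q(1) X(3) by (intro divide_left_mono mult_pos_pos) auto
        then have A: "6 * real L / real q \<le> 6 * real L * X powr (- \<eta>)"
          by (simp add: powr_minus divide_inverse)
        have "40 * real q ^ 3 * real L * (\<mu> * real L ^ k) powr (- 1 / 2 ^ k) \<le>
            40 * (2 * X powr \<eta>) ^ 3 * real L * X powr (- 4 * \<eta>)"
          using q(2) p(2) by (intro mult_mono power_mono) (auto simp: \<mu>_def)
        also have "(2 * X powr \<eta>) ^ 3 = 8 * X powr (3 * \<eta>)"
          using X(1) by (simp add: power_mult_distrib powr_powr mult.commute flip: powr_realpow)
        also have "40 * (8 * X powr (3 * \<eta>)) * real L * X powr (- 4 * \<eta>) =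
            320 * real L * (X powr (3 * \<eta>) * X powr (- 4 * \<eta>))" by simp
        also have "X powr (3 * \<eta>) * X powr (- 4 * \<eta>) = X powr (- \<eta>)" by (simp flip: powr_add)
        finally show "6 * real L / real q + 40 * real q ^ 3 * real L * (\<mu> * real L ^ Suc (l + 1)) powr (- 1 / 2 ^ Suc (l + 1))
           \<le> 326 * real L * X powr (- \<eta>)" unfolding kk using A by linarith
      qed simp
      also have "\<dots> = 326 * (real M' + real L) * X powr (- \<eta>)" using L1 by (simp add: field_simps)
      also have "\<dots> \<le> 326 * (3 * X) * X powr (- \<eta>)"
      proof (intro mult_right_mono mult_left_mono)
        have "X powr \<tau> \<le> X powr 1" using p(3) X(1) by (intro powr_mono) auto
        then have "real L \<le> 2 * X" using L(2) X(1) by simp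
        moreover have "real M \<le> X"
        proof -
          have "1 + 1 * (real M - 1) \<le> real y0 + real a * (real M - 1)"
            using a1 M y0 by (intro add_mono mult_right_mono) auto
          also note leX
          finally show ?thesis by simp
        qed
        moreover have "real M' \<le> real M" by (simp add: MM)
        ultimately show "real M' + real L \<le> 3 * X" by linarith
      qed auto
      also have "\<dots> = 978 * X powr (1 - \<eta>)" using X(1) by (simp add: powr_diff powr_minus field_simps)
      also have "\<dots> \<le> 978 * X powr (1 - \<sigma>)" using p(5) X(1) by (intro mult_left_mono powr_mono) auto
      finally have tail: "\<bar>\<Sum>n<M'. ?u (n0 + n)\<bar> \<le> 978 * X powr (1 - \<sigma>)"
        by (simp add: g0 algebra_simps)
      have "(\<Sum>n<M. ?u n) = (\<Sum>n<n0. ?u n) + (\<Sum>n<M'. ?u (n0 + n))"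
        unfolding MM by (induction M') (simp_all add: add.assoc)
      moreover have "\<bar>\<Sum>n<n0. ?u n\<bar> \<le> real n0" using abs_chi_sum_le[of _ "{..<n0}"] by simp
      ultimately show ?thesis using tail n0(2) by linarith
    qed
    then show "\<bar>\<Sum>n<M. ?u n\<bar> \<le> 980 * real N powr (1 - \<sigma>)" by (simp add: X_def)
  qed
qed

section \<open>Passage to the well-distribution measure\<close>

text \<open>The offset b may be negative, but the first index a + b is at least 1. Taking it as the
  natural number \<open>y0\<close> moves the summation range from 1..M to 0..M - 1.\<close>

lemma well_distribution_values_sign_sequence:
  assumes "v \<in> well_distribution_values (sign_sequence N f)"
  obtains a y0 M :: nat where "1 \<le> a" "1 \<le> M" "1 \<le> y0" "y0 + a * (M - 1) \<le> N"
    "real_of_int v = \<bar>\<Sum>n<M. real_of_int (chi (f (real y0 + real a * real n)))\<bar>"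
proof -
  have len: "length (sign_sequence N f) = N" by (simp add: sign_sequence_def del: upt_Suc)
  from assms obtain a :: nat and b :: int and M :: nat where
    v: "v = \<bar>\<Sum>n = 1..M. sign_sequence N f ! nat (int a * int n + b - 1)\<bar>"
    and a: "1 \<le> a" and M: "1 \<le> M" and b: "1 \<le> int a + b" and hi: "int a * int M + b \<le> int N"
    unfolding well_distribution_values_def by (auto simp: len)
  define y0 where "y0 = nat (int a + b)"
  have y0: "int y0 = int a + b" "1 \<le> y0" using b by (simp_all add: y0_def)
  have top: "y0 + a * (M - 1) \<le> N"
  proof -
    have "int (y0 + a * (M - 1)) = int a * int M + b"
      using M by (simp only: of_nat_add of_nat_mult of_nat_diff y0(1)) (simp add: algebra_simps)
    then show ?thesis using hi by linarith
  qed
  have "(\<Sum>n = 1..M. sign_sequence N f ! nat (int a * int n + b - 1)) =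
     (\<Sum>n<M. chi (f (real y0 + real a * real n)))"
  proof (rule sum.reindex_bij_witness[of _ Suc "\<lambda>n. n - 1"])
    fix n assume n: "n \<in> {1..M}"
    have "int a * int n + b - 1 = int (y0 + a * (n - 1)) - 1"
      using n by (simp only: atLeastAtMost_iff of_nat_add of_nat_mult of_nat_diff y0(1)) (simp add: algebra_simps)
    then have idx: "nat (int a * int n + b - 1) = y0 + a * (n - 1) - 1" by linarith
    have "a * (n - 1) \<le> a * (M - 1)" using n by (intro mult_left_mono) auto
    then have "y0 + a * (n - 1) - 1 < N" using top y0(2) by linarith
    then show "chi (f (real y0 + real a * real (n - 1))) = sign_sequence N f ! nat (int a * int n + b - 1)"
      unfolding idx sign_sequence_def using y0(2) by (simp del: upt_Suc add: nth_upt)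
  qed auto
  then show ?thesis using that[OF a M y0(2) top] v by simp
qed

theorem theorem1:
  fixes l :: nat and f :: "real \<Rightarrow> real"
  assumes "f \<in> hardy_functions"
    and "of_type_power_plus l f"
  shows "\<exists>\<sigma>>0. \<forall>\<epsilon>>0. \<exists>C. \<forall>N\<ge>1.
    real_of_int (well_distribution (sign_sequence N f)) \<le> C * real N powr (1 - \<sigma> + \<epsilon>)"
proof -
  obtain K where "hardy_field K" "germ_of f \<in> K"
    using assms(1) by (auto simp: hardy_functions_def)
  then interpret hardy K by unfold_locales
  have "mem f" using \<open>germ_of f \<in> K\<close> by (simp add: mem_def)
  then obtain \<sigma> :: real and N0 :: nat where sig: "0 < \<sigma>" "\<sigma> \<le> 1" and main:
    "\<And>N a y0 M :: nat. N0 \<le> N \<Longrightarrow> 1 \<le> a \<Longrightarrow> 1 \<le> M \<Longrightarrow> y0 \<ge> 1 \<Longrightarrow> y0 + a * (M - 1) \<le> N \<Longrightarrow>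
       \<bar>\<Sum>n<M. real_of_int (chi (f (real y0 + real a * real n)))\<bar> \<le> 980 * real N powr (1 - \<sigma>)"
    using chi_progression_power_saving[OF _ assms(2)] by blast
  \<comment> \<open>The summand N0 takes care of N < N0, where a progression inside 1..N has at most
    N0 terms and the power of N is at least 1, its exponent being nonnegative by \<sigma> \<le>
    1.\<close>
  have "real_of_int (well_distribution (sign_sequence N f)) \<le> (980 + real N0) * real N powr (1 - \<sigma> + \<epsilon>)"
    if N: "1 \<le> N" and eps: "0 < \<epsilon>" for N :: nat and \<epsilon> :: real
  proof -
    have "sign_sequence N f \<noteq> []" using N by (simp add: sign_sequence_def)
    then have "well_distribution (sign_sequence N f) \<in> well_distribution_values (sign_sequence N f)"
      unfolding well_distribution_def
      by (intro Max_in finite_well_distribution_values well_distribution_values_nonempty)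
    then obtain a y0 M :: nat where w: "1 \<le> a" "1 \<le> M" "1 \<le> y0" "y0 + a * (M - 1) \<le> N"
      "real_of_int (well_distribution (sign_sequence N f)) =
        \<bar>\<Sum>n<M. real_of_int (chi (f (real y0 + real a * real n)))\<bar>"
      by (rule well_distribution_values_sign_sequence)
    have ge1: "1 \<le> real N powr (1 - \<sigma> + \<epsilon>)" using N sig eps by (intro ge_one_powr_ge_zero) auto
    show ?thesis
    proof (cases "N0 \<le> N")
      case True
      have "real_of_int (well_distribution (sign_sequence N f)) \<le> 980 * real N powr (1 - \<sigma>)"
        unfolding w(5) by (rule main[OF True w(1,2,3,4)])
      also have "\<dots> \<le> (980 + real N0) * real N powr (1 - \<sigma> + \<epsilon>)"
        using N eps by (intro mult_mono powr_mono) auto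
      finally show ?thesis .
    next
      case False
      have "1 * (M - 1) \<le> a * (M - 1)" using w(1) by (intro mult_right_mono) auto
      then have "M \<le> N0" using w(3,4) False by linarith
      then have "real_of_int (well_distribution (sign_sequence N f)) \<le> real N0"
        unfolding w(5) using abs_chi_sum_le[of "\<lambda>n. f (real y0 + real a * real n)" "{..<M}"] by simp
      also have "\<dots> \<le> (980 + real N0) * 1" by simp
      also have "\<dots> \<le> (980 + real N0) * real N powr (1 - \<sigma> + \<epsilon>)"
        using ge1 by (intro mult_left_mono) auto
      finally show ?thesis .
    qed
  qed
  then show ?thesis using sig(1) by blast
qed

end
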